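(* For $s\in\mathbb R$ let $E_{1,2}(s)$ denote the semi-infinite matrix equal to the identity plus the single additional entry $s$ in the second row and first column. (1) Let $T$ be an oscillatory tetradiagonal Hessenberg matrix with associated infinite continued fraction $\mathcal K[1]$. Then for every $s>-\mathcal K[1]$ the tetradiagonal matrix $T_s=E_{1,2}(s)T$, i.e. the matrix obtained from $T$ by replacing $b_1$ by $b_1+sc_0$ and $c_1$ by $c_1+s$, has a PBF. (2) Let $T$ be a tetradiagonal Hessenberg matrix that admits a PBF, i.e. with $\mathcal K[1]>0$. Then the tetradiagonal matrix $\tilde T=E_{1,2}(-\mathcal K[1])T$, i.e. the matrix obtained from $T$ by replacing $b_1$ by $b_1-\mathcal K[1]c_0$ and $c_1$ by $c_1-\mathcal K[1]$, is an oscillatory matrix that does not admit a PBF, i.e. its associated infinite continued fraction satisfies $\tilde{\mathcal K}[1]=0$.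
   Context: A tetradiagonal Hessenberg matrix is a real semi-infinite matrix $T=(T_{i,j})_{i,j\ge0}$ with $T_{n,n+1}=1$, $T_{n,n}=c_n$ ($n\ge0$), $T_{n,n-1}=b_n$ ($n\ge1$), $T_{n,n-2}=a_n$ ($n\ge2$), all other entries $0$, and $a_n>0$ for all $n\ge2$. $T^{[N]}$ is the leading principal submatrix with rows and columns $0,\dots,N$. A finite matrix is TN if all its minors are nonnegative, and oscillatory if it is TN and some power of it has all minors positive (equivalently, TN, irreducible and nonsingular). A semi-infinite matrix is oscillatory if all its leading principal submatrices are. A PBF (positive bidiagonal factorization) of $T$ is a factorization $T=L_1L_2U$ where $L_1$ is lower unitriangular bidiagonal with first subdiagonal $(\alpha_2,\alpha_5,\alpha_8,\dots)$, $L_2$ is lower unitriangular bidiagonal with first subdiagonal $(\alpha_3,\alpha_6,\alpha_9,\dots)$, $U$ is upper bidiagonal with diagonal $(\alpha_1,\alpha_4,\alpha_7,\dots)$ and first superdiagonal of ones, and $\alpha_j>0$ for all $j\in\mathbb N$. A matrix admitting a PBF is oscillatory. For $T$ oscillatory let $\delta^{[n]}=\det T^{[n]}>0$, $\delta^{[-1]}=1$. The Gauss--Borel factorization is the unique factorization $T=LU$ with $U$ upper bidiagonal with first superdiagonal of ones and diagonal $(\alpha_1,\alpha_4,\alpha_7,\dots)$, and $L$ lower unitriangular with $L_{n,n-1}=m_n$ ($n\ge1$), $L_{n,n-2}=l_n$ ($n\ge2$), other subdiagonal entries zero; explicitly $\alpha_{3n+1}=\delta^{[n]}/\delta^{[n-1]}$,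 $m_n=c_n-\alpha_{3n+1}$, $l_n=a_n/\alpha_{3n-5}$. For $n\ge k\ge1$ let $$\mathcal K[n,k]=m_k-\cfrac{l_{k+1}}{m_{k+1}-\cfrac{l_{k+2}}{\ddots-\cfrac{l_n}{m_n}}},\qquad \mathcal K[k,k]=m_k.$$ The infinite continued fraction associated with $T$ is $\mathcal K[1]=\lim_{n\to\infty}\mathcal K[n,1]$ (this limit exists and is nonnegative). $\tilde{\mathcal K}[1]$ denotes the quantity constructed in the same way from $\tilde T$. *)

theory Defs
  imports Complex_Main
    "Jordan_Normal_Form.Determinant"
    "Jordan_Normal_Form.DL_Submatrix"
begin

text \<open>Semi-infinite real matrices, with rows and columns indexed from 0.\<close>

type_synonym inf_mat = "nat \<Rightarrow> nat \<Rightarrow> real"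

text \<open>In every product formed below the sum has only finitely many nonzero terms: the left
  factor has only finitely many nonzero entries in each row.\<close>

definition inf_mult :: "inf_mat \<Rightarrow> inf_mat \<Rightarrow> inf_mat"  (infixl "\<odot>" 70) where
  "A \<odot> B = (\<lambda>i j. \<Sum>k. A i k * B k j)"

text \<open>\<open>truncation T N\<close> is the leading principal submatrix with rows and columns \<open>0, \<dots>, N\<close>, so it
  has size \<open>N + 1\<close>.\<close>

definition truncation :: "inf_mat \<Rightarrow> nat \<Rightarrow> real mat" where
  "truncation T N = mat (Suc N) (Suc N) (\<lambda>(i, j). T i j)"

definition tetradiagonal_hessenberg :: "inf_mat \<Rightarrow> bool" where
  "tetradiagonal_hessenberg T \<longleftrightarrow>
     (\<forall>n. T n (n + 1) = 1) \<and>
     (\<forall>n\<ge>2. T n (n - 2) > 0) \<and>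
     (\<forall>i j. j > i + 1 \<or> i > j + 2 \<longrightarrow> T i j = 0)"

definition totally_nonneg :: "real mat \<Rightarrow> bool" where
  "totally_nonneg A \<longleftrightarrow>
     (\<forall>I J. I \<subseteq> {..<dim_row A} \<longrightarrow> J \<subseteq> {..<dim_col A} \<longrightarrow> card I = card J \<longrightarrow>
        det (submatrix A I J) \<ge> 0)"

definition totally_pos :: "real mat \<Rightarrow> bool" where
  "totally_pos A \<longleftrightarrow>
     (\<forall>I J. I \<subseteq> {..<dim_row A} \<longrightarrow> J \<subseteq> {..<dim_col A} \<longrightarrow> card I = card J \<longrightarrow>
        det (submatrix A I J) > 0)"

text \<open>The exponent is positive: the zeroth power of any 1 by 1 matrix, even of the zero matrix,
  has all minors positive.\<close>

definition oscillatory_mat :: "real mat \<Rightarrow> bool" where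
  "oscillatory_mat A \<longleftrightarrow>
     square_mat A \<and> totally_nonneg A \<and> (\<exists>k\<ge>1. totally_pos (A ^\<^sub>m k))"

definition oscillatory :: "inf_mat \<Rightarrow> bool" where
  "oscillatory T \<longleftrightarrow> (\<forall>N. oscillatory_mat (truncation T N))"

definition lower_bidiag :: "(nat \<Rightarrow> real) \<Rightarrow> inf_mat" where
  "lower_bidiag x = (\<lambda>i j. if i = j then 1 else if i = Suc j then x j else 0)"

definition upper_bidiag :: "(nat \<Rightarrow> real) \<Rightarrow> inf_mat" where
  "upper_bidiag d = (\<lambda>i j. if i = j then d i else if j = Suc i then 1 else 0)"

text \<open>Positive bidiagonal factorization, with parameters \<open>\<alpha> 1, \<alpha> 2, \<dots>\<close>; the value \<open>\<alpha> 0\<close> is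
  not used.\<close>

definition has_PBF :: "inf_mat \<Rightarrow> bool" where
  "has_PBF T \<longleftrightarrow> (\<exists>\<alpha>. (\<forall>j\<ge>1. \<alpha> j > 0) \<and>
     T = lower_bidiag (\<lambda>j. \<alpha> (3 * j + 2)) \<odot> lower_bidiag (\<lambda>j. \<alpha> (3 * j + 3))
           \<odot> upper_bidiag (\<lambda>j. \<alpha> (3 * j + 1)))"

definition leading_minor :: "inf_mat \<Rightarrow> nat \<Rightarrow> real" where
  "leading_minor T n = det (truncation T n)"

text \<open>The Gauss--Borel factors of \<open>T\<close>: \<open>gb_diag T n\<close> is the diagonal entry \<open>\<alpha>\<close> with index
  \<open>3 n + 1\<close> of \<open>U\<close>, and \<open>gb_m T n\<close> and \<open>gb_l T n\<close> are the entries of \<open>L\<close> at positions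
  \<open>(n, n - 1)\<close> (meaningful for \<open>n \<ge> 1\<close>) and \<open>(n, n - 2)\<close> (meaningful for \<open>n \<ge> 2\<close>). The lemmas
  \<open>gauss_borel_factorization\<close> and \<open>gauss_borel_unique\<close> justify the explicit formulas.\<close>

definition gb_diag :: "inf_mat \<Rightarrow> nat \<Rightarrow> real" where
  "gb_diag T n = leading_minor T n / (if n = 0 then 1 else leading_minor T (n - 1))"

definition gb_m :: "inf_mat \<Rightarrow> nat \<Rightarrow> real" where
  "gb_m T n = T n n - gb_diag T n"

definition gb_l :: "inf_mat \<Rightarrow> nat \<Rightarrow> real" where
  "gb_l T n = T n (n - 2) / gb_diag T (n - 2)"

text \<open>The finite continued fraction \<open>K[n, k]\<close>, meaningful for \<open>n \<ge> k \<ge> 1\<close>.\<close>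

function cont_frac :: "inf_mat \<Rightarrow> nat \<Rightarrow> nat \<Rightarrow> real" where
  "cont_frac T n k =
     (if k < n then gb_m T k - gb_l T (Suc k) / cont_frac T n (Suc k) else gb_m T k)"
  by pat_completeness auto
termination by (relation "measure (\<lambda>(T, n, k). n - k)") auto

declare cont_frac.simps [simp del]

definition inf_cont_frac :: "inf_mat \<Rightarrow> real" where
  "inf_cont_frac T = lim (\<lambda>n. cont_frac T n 1)"

text \<open>The matrix \<open>E\<^sub>1\<^sub>,\<^sub>2(s)\<close>: the extra entry is in the second row and first column.\<close>

definition E12 :: "real \<Rightarrow> inf_mat" where
  "E12 s = (\<lambda>i j. if i = j then 1 else if i = 1 \<and> j = 0 then s else 0)"

text \<open>Replace the entries \<open>b\<^sub>1\<close> at \<open>(1, 0)\<close> and \<open>c\<^sub>1\<close> at \<open>(1, 1)\<close>.\<close>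

definition replace_b1_c1 :: "inf_mat \<Rightarrow> real \<Rightarrow> real \<Rightarrow> inf_mat" where
  "replace_b1_c1 T b c =
     (\<lambda>i j. if i = 1 \<and> j = 0 then b else if i = 1 \<and> j = 1 then c else T i j)"


subsection \<open>Existence and uniqueness of the Gauss--Borel factorization\<close>

definition lower_tridiag :: "(nat \<Rightarrow> real) \<Rightarrow> (nat \<Rightarrow> real) \<Rightarrow> inf_mat" where
  "lower_tridiag m l =
     (\<lambda>i j. if i = j then 1 else if i = j + 1 then m i else if i = j + 2 then l i else 0)"

lemma mult_upper_bidiag:
  "(L \<odot> upper_bidiag d) i j = L i j * d j + (if j = 0 then 0 else L i (j - 1))"
proof -
  have "(\<Sum>k. L i k * upper_bidiag d k j) = (\<Sum>k\<in>{j, j - 1}. L i k * upper_bidiag d k j)"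
    by (rule suminf_finite) (auto simp: upper_bidiag_def)
  then show ?thesis
    by (cases j) (auto simp: inf_mult_def upper_bidiag_def)
qed

lemma truncation_mult_lower:
  assumes "\<And>i k. i < k \<Longrightarrow> L i k = 0"
  shows "truncation (L \<odot> U) N = truncation L N * truncation U N"
proof (rule eq_matI)
  fix i j
  assume "i < dim_row (truncation L N * truncation U N)"
    "j < dim_col (truncation L N * truncation U N)"
  then have ij: "i < Suc N" "j < Suc N"
    by (auto simp: truncation_def)
  have "(L \<odot> U) i j = (\<Sum>k\<in>{0..<Suc N}. L i k * U k j)"
    unfolding inf_mult_def by (rule suminf_finite) (use ij assms in auto)
  then show "truncation (L \<odot> U) N $$ (i, j) = (truncation L N * truncation U N) $$ (i, j)"
    using ij by (simp add: truncation_def scalar_prod_def)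
qed (auto simp: truncation_def)

lemma truncation_carrier [simp]: "truncation T N \<in> carrier_mat (Suc N) (Suc N)"
  by (simp add: truncation_def)

lemma det_truncation_lower_upper:
  "det (truncation (lower_tridiag m l \<odot> upper_bidiag d) N) = (\<Prod>k\<le>N. d k)"
proof -
  have "det (truncation (lower_tridiag m l) N) = prod_list (diag_mat (truncation (lower_tridiag m l) N))"
    by (rule det_lower_triangular[OF _ truncation_carrier])
      (auto simp: truncation_def lower_tridiag_def)
  also have "diag_mat (truncation (lower_tridiag m l) N) = map (\<lambda>_. 1) [0..<Suc N]"
    unfolding diag_mat_def by (rule map_cong) (auto simp: truncation_def lower_tridiag_def)
  also have "prod_list \<dots> = 1"
    by (induction N) auto
  finally have L: "det (truncation (lower_tridiag m l) N) = 1" .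
  have "det (truncation (upper_bidiag d) N) = prod_list (diag_mat (truncation (upper_bidiag d) N))"
    by (rule det_upper_triangular[OF _ truncation_carrier])
      (auto simp: truncation_def upper_bidiag_def upper_triangular_def)
  also have "diag_mat (truncation (upper_bidiag d) N) = map d [0..<Suc N]"
    unfolding diag_mat_def by (rule map_cong) (auto simp: truncation_def upper_bidiag_def)
  also have "prod_list \<dots> = (\<Prod>k\<in>{0..<Suc N}. d k)"
    by (subst prod.distinct_set_conv_list[symmetric]) auto
  also have "{0..<Suc N} = {..N}" by auto
  finally have U: "det (truncation (upper_bidiag d) N) = (\<Prod>k\<le>N. d k)" .
  have "truncation (lower_tridiag m l \<odot> upper_bidiag d) N
      = truncation (lower_tridiag m l) N * truncation (upper_bidiag d) N"
    by (rule truncation_mult_lower) (auto simp: lower_tridiag_def)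
  then show ?thesis
    using det_mult[OF truncation_carrier truncation_carrier] L U by simp
qed

lemma gauss_borel_unique:
  assumes nz: "\<And>n. leading_minor T n \<noteq> 0"
    and T: "T = lower_tridiag m l \<odot> upper_bidiag d"
  shows "d n = gb_diag T n"
    and "n \<ge> 1 \<Longrightarrow> m n = gb_m T n"
    and "n \<ge> 2 \<Longrightarrow> l n = gb_l T n"
proof -
  have lm: "leading_minor T n = (\<Prod>k\<le>n. d k)" for n
    unfolding leading_minor_def T by (rule det_truncation_lower_upper)
  have d: "d n = gb_diag T n" for n
    using lm[of n] lm[of "n - 1"] nz[of "n - 1"] by (cases n) (auto simp: gb_diag_def)
  have d0: "d n \<noteq> 0" for n
    using nz[of n] lm[of n] by auto
  show "d n = gb_diag T n" by (rule d)
  show "m n = gb_m T n" if "n \<ge> 1"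
    using that d[of n] arg_cong[OF T, of "\<lambda>A. A n n"]
    by (auto simp: gb_m_def mult_upper_bidiag lower_tridiag_def)
  show "l n = gb_l T n" if "n \<ge> 2"
  proof -
    have "T n (n - 2) = l n * d (n - 2)"
      using that by (subst T) (auto simp: mult_upper_bidiag lower_tridiag_def)
    then show ?thesis
      using d0[of "n - 2"] d[of "n - 2"] by (simp add: gb_l_def)
  qed
qed

fun elim_diag :: "inf_mat \<Rightarrow> nat \<Rightarrow> real" where
  "elim_diag T 0 = T 0 0"
| "elim_diag T (Suc 0) = T 1 1 - T 1 0 / elim_diag T 0"
| "elim_diag T (Suc (Suc n)) = T (n + 2) (n + 2)
     - (T (n + 2) (n + 1) - T (n + 2) n / elim_diag T n) / elim_diag T (Suc n)"

lemma gauss_borel_factorization: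
  assumes T: "tetradiagonal_hessenberg T"
    and nz: "\<And>n. leading_minor T n \<noteq> 0"
  shows "T = lower_tridiag (gb_m T) (gb_l T) \<odot> upper_bidiag (gb_diag T)"
proof -
  define d where "d = elim_diag T"
  define l where "l = (\<lambda>n. T n (n - 2) / d (n - 2))"
  define m where "m = (\<lambda>n. T n n - d n)"
  define S where "S = lower_tridiag m l \<odot> upper_bidiag d"
  have m1: "m 1 = T 1 0 / d 0"
    by (simp add: m_def d_def)
  have m2: "m (Suc (Suc n)) = (T (n + 2) (n + 1) - l (n + 2)) / d (Suc n)" for n
    by (simp add: m_def d_def l_def)
  have entry: "S i j = T i j" if "\<And>k. k < i \<Longrightarrow> d k \<noteq> 0" for i j
  proof -
    consider "i + 1 < j" | "j = i + 1" | "j = i" | "i = j + 1" | "i = j + 2" | "j + 2 < i"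
      by linarith
    then show ?thesis
    proof cases
      case 3
      then show ?thesis
        by (cases i) (auto simp: S_def mult_upper_bidiag lower_tridiag_def m_def d_def)
    next
      case 4
      then show ?thesis
        using that[of j] m1 m2[of "j - 1"]
        by (cases j) (auto simp: S_def mult_upper_bidiag lower_tridiag_def)
    next
      case 5
      then show ?thesis
        using that[of j] T
        by (cases j) (auto simp: S_def mult_upper_bidiag lower_tridiag_def l_def)
    qed (use T in \<open>auto simp: S_def mult_upper_bidiag lower_tridiag_def
        tetradiagonal_hessenberg_def\<close>)
  qed
  have d0: "d n \<noteq> 0" for n
  proof (induction n rule: less_induct)
    case (less n)
    have "truncation T n = truncation S n"
      unfolding truncation_def by (rule cong_mat) (auto intro!: entry[symmetric] less)
    then have "leading_minor T n = (\<Prod>k\<le>n. d k)"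
      unfolding leading_minor_def S_def by (simp add: det_truncation_lower_upper)
    then show ?case using nz[of n] by auto
  qed
  have TS: "T = S"
    by (intro ext) (simp add: entry d0)
  note u = gauss_borel_unique[OF nz TS[unfolded S_def]]
  have "lower_tridiag m l = lower_tridiag (gb_m T) (gb_l T)"
    by (intro ext) (auto simp: lower_tridiag_def u)
  moreover have "d = gb_diag T"
    by (intro ext u)
  ultimately show ?thesis
    using TS unfolding S_def by metis
qed

end

theory Submission
  imports Defs
begin

text \<open>Multiplying \<open>T = L U\<close> by \<open>E\<^sub>1\<^sub>,\<^sub>2(s)\<close> only replaces \<open>m\<^sub>1\<close> by \<open>m\<^sub>1 + s\<close> in \<open>L\<close>. When all
  \<open>K[n, k]\<close> are positive they decrease in \<open>n\<close>, and their limits \<open>\<kappa>\<^sub>k\<close> satisfy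
  \<open>\<kappa>\<^sub>k = m\<^sub>k - l\<^sub>k\<^sub>+\<^sub>1 / \<kappa>\<^sub>k\<^sub>+\<^sub>1\<close>, which says that \<open>L = L\<^sub>1 L\<^sub>2\<close> with bidiagonal factors having
  subdiagonals \<open>\<kappa>\<^sub>j\<^sub>+\<^sub>1\<close> and \<open>l\<^sub>j\<^sub>+\<^sub>2 / \<kappa>\<^sub>j\<^sub>+\<^sub>2\<close>. All these entries are positive except possibly
  \<open>\<kappa>\<^sub>1 = K[1]\<close>, the one entry that is shifted by \<open>s\<close>. This gives (1) as soon as \<open>K[n, k] > 0\<close> is
  known for oscillatory \<open>T\<close>; there \<open>K[n, k]\<close> is a quotient of two consecutive minors that appear
  in the last row of the adjugate of \<open>T\<^sup>[\<^sup>n\<^sup>]\<close>. At the critical \<open>s = - K[1]\<close> the first subdiagonal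
  entry of \<open>L\<^sub>1\<close> vanishes, but \<open>L\<^sub>2\<close> and \<open>U\<close> alone still connect all column sets of the same
  size, so a power of each truncation has only positive minors.\<close>

section \<open>Continued fractions and bidiagonal factors\<close>

lemma E12_mult: "(E12 s \<odot> T) i j = T i j + (if i = 1 then s * T 0 j else 0)"
proof -
  have "(\<Sum>k. E12 s i k * T k j) = (\<Sum>k\<in>{0, i}. E12 s i k * T k j)"
    by (rule suminf_finite) (auto simp: E12_def)
  then show ?thesis
    by (cases "i = 0") (auto simp: inf_mult_def E12_def)
qed

lemma E12_mult_eq_replace:
  assumes "tetradiagonal_hessenberg T"
  shows "E12 s \<odot> T = replace_b1_c1 T (T 1 0 + s * T 0 0) (T 1 1 + s)"
proof -
  have "T 0 (0 + 1) = 1"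
    using assms by (auto simp only: tetradiagonal_hessenberg_def)
  moreover have "T 0 j = 0" if "j \<noteq> 0" "j \<noteq> 1" for j
  proof -
    have "j > 0 + 1"
      using that by simp
    then show ?thesis
      using assms unfolding tetradiagonal_hessenberg_def by blast
  qed
  ultimately show ?thesis
    by (intro ext) (simp add: E12_mult replace_b1_c1_def)
qed

lemma tetradiagonal_hessenberg_E12_mult:
  assumes "tetradiagonal_hessenberg T"
  shows "tetradiagonal_hessenberg (E12 s \<odot> T)"
  using assms by (auto simp: E12_mult_eq_replace tetradiagonal_hessenberg_def replace_b1_c1_def)

text \<open>Row 0 of the left factor is the first unit vector, so adding \<open>s\<close> times row
  0 to row 1 touches only the entry \<open>m 1\<close>.\<close>

lemma E12_mult_lower_tridiag:
  "E12 s \<odot> (lower_tridiag m l \<odot> upper_bidiag d)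
    = lower_tridiag (m(1 := m 1 + s)) l \<odot> upper_bidiag d"
proof (intro ext)
  fix i j :: nat
  show "(E12 s \<odot> (lower_tridiag m l \<odot> upper_bidiag d)) i j
      = (lower_tridiag (m(1 := m 1 + s)) l \<odot> upper_bidiag d) i j"
    by (cases "j = 0"; cases "j = 1")
      (auto simp: E12_mult mult_upper_bidiag lower_tridiag_def algebra_simps)
qed

lemma mult_lower_bidiag: "(L \<odot> lower_bidiag x) i j = L i j + L i (Suc j) * x j"
proof -
  have "(\<Sum>k. L i k * lower_bidiag x k j) = (\<Sum>k\<in>{j, Suc j}. L i k * lower_bidiag x k j)"
    by (rule suminf_finite) (auto simp: lower_bidiag_def)
  then show ?thesis
    by (auto simp: inf_mult_def lower_bidiag_def)
qed

lemma lower_bidiag_mult_lower_bidiag: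
  assumes "\<And>n. n \<ge> 1 \<Longrightarrow> m n = x (n - 1) + y (n - 1)"
    and "\<And>n. n \<ge> 2 \<Longrightarrow> l n = x (n - 1) * y (n - 2)"
  shows "lower_bidiag x \<odot> lower_bidiag y = lower_tridiag m l"
  unfolding fun_eq_iff mult_lower_bidiag
  by (auto simp: lower_tridiag_def lower_bidiag_def assms)

lemma has_PBF_I:
  assumes "\<And>j. x j > 0" "\<And>j. y j > 0" "\<And>j. d j > 0"
  shows "has_PBF (lower_bidiag x \<odot> lower_bidiag y \<odot> upper_bidiag d)"
proof -
  \<comment> \<open>The three sequences are interleaved by residue mod 3. The index 3 j + 3 has
    quotient j + 1, hence the shift by one in the last case.\<close>
  define \<alpha> where "\<alpha> = (\<lambda>j::nat. if j mod 3 = 1 then d (j div 3)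
      else if j mod 3 = 2 then x (j div 3) else y (j div 3 - 1))"
  have "(3 * j + 1) mod 3 = 1" "(3 * j + 1) div 3 = j" "(3 * j + 2) mod 3 = 2"
    "(3 * j + 2) div 3 = j" "(3 * j + 3) mod 3 = 0" "(3 * j + 3) div 3 = Suc j" for j :: nat
    by presburger+
  then have "(\<lambda>j. \<alpha> (3 * j + 2)) = x" "(\<lambda>j. \<alpha> (3 * j + 3)) = y" "(\<lambda>j. \<alpha> (3 * j + 1)) = d"
    unfolding \<alpha>_def by (simp_all only:) simp_all
  then show ?thesis
    unfolding has_PBF_def by (intro exI[of _ \<alpha>]) (use assms in \<open>auto simp: \<alpha>_def\<close>)
qed

lemma has_PBF_E:
  assumes "has_PBF T"
  obtains x y d where "\<And>j. x j > 0" "\<And>j. y j > 0" "\<And>j. d j > 0"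
    "T = lower_bidiag x \<odot> lower_bidiag y \<odot> upper_bidiag d"
proof -
  obtain \<alpha> where pos: "\<And>j. j \<ge> 1 \<Longrightarrow> \<alpha> j > 0"
    and T: "T = lower_bidiag (\<lambda>j. \<alpha> (3 * j + 2)) \<odot> lower_bidiag (\<lambda>j. \<alpha> (3 * j + 3))
      \<odot> upper_bidiag (\<lambda>j. \<alpha> (3 * j + 1))"
    using assms unfolding has_PBF_def by blast
  show ?thesis
    by (rule that[OF _ _ _ T]) (simp_all add: pos)
qed

lemma leading_minor_lower_upper:
  assumes "T = lower_tridiag m l \<odot> upper_bidiag d"
  shows "leading_minor T n = (\<Prod>k\<le>n. d k)"
  unfolding leading_minor_def assms by (rule det_truncation_lower_upper)

lemma gauss_borel_pos:
  assumes "\<And>n. leading_minor T n > 0"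
  shows "gb_diag T n > 0"
  using assms by (simp add: gb_diag_def)

section \<open>Monotonicity and limits of the continued fractions\<close>

lemma cont_frac_last: "cont_frac T n n = gb_m T n"
  by (subst cont_frac.simps) simp

lemma cont_frac_rec:
  "k < n \<Longrightarrow> cont_frac T n k = gb_m T k - gb_l T (Suc k) / cont_frac T n (Suc k)"
  by (subst cont_frac.simps) simp

text \<open>Going from \<open>n\<close> to \<open>Suc n\<close> lowers the innermost term
  \<open>gb_m T n\<close> by a positive quotient, and each outer level preserves the order because m
  - l / t increases with t > 0. Positivity is asked from index 2 on, so that the lemma can later
  upgrade a nonnegative \<open>cont_frac T n 1\<close> to a positive one.\<close>

lemma cont_frac_Suc_less:
  assumes l: "\<And>n. n \<ge> 2 \<Longrightarrow> gb_l T n > 0"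
    and pos: "\<And>n k. 2 \<le> k \<Longrightarrow> k \<le> n \<Longrightarrow> cont_frac T n k > 0"
    and k: "1 \<le> k" "k \<le> n"
  shows "cont_frac T (Suc n) k < cont_frac T n k"
  using k(2,1)
proof (induction rule: inc_induct)
  case base
  then show ?case
    using l[of "Suc n"] pos[of "Suc n" "Suc n"]
    by (simp add: cont_frac_last cont_frac_rec[of n "Suc n"])
next
  case (step k)
  have "0 < gb_l T (Suc k)" "0 < cont_frac T (Suc n) (Suc k)"
    using l[of "Suc k"] pos[of "Suc k" "Suc n"] step by auto
  moreover have "cont_frac T (Suc n) (Suc k) < cont_frac T n (Suc k)"
    using step by auto
  ultimately have "gb_l T (Suc k) / cont_frac T n (Suc k)
      < gb_l T (Suc k) / cont_frac T (Suc n) (Suc k)"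
    by (intro divide_strict_left_mono) auto
  then show ?case
    using step by (simp add: cont_frac_rec)
qed

text \<open>Each sequence decreases and is bounded below by 0. Passing to the limit in the recursion
  needs nonzero limits of the tails; only the first limit may vanish.\<close>

lemma cont_frac_limits:
  assumes l: "\<And>n. n \<ge> 2 \<Longrightarrow> gb_l T n > 0"
    and pos: "\<And>n k. 1 \<le> k \<Longrightarrow> k \<le> n \<Longrightarrow> cont_frac T n k > 0"
  obtains \<kappa> where "\<And>k. k \<ge> 1 \<Longrightarrow> (\<lambda>n. cont_frac T n k) \<longlonglongrightarrow> \<kappa> k"
    "\<And>k. k \<ge> 1 \<Longrightarrow> \<kappa> k \<ge> 0" "\<And>k. k \<ge> 2 \<Longrightarrow> \<kappa> k > 0"
    "\<And>k. k \<ge> 1 \<Longrightarrow> \<kappa> k = gb_m T k - gb_l T (Suc k) / \<kappa> (Suc k)"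
proof -
  have "\<exists>c. (\<lambda>n. cont_frac T n k) \<longlonglongrightarrow> c" if k: "k \<ge> 1" for k
  proof -
    have "convergent (\<lambda>n. cont_frac T (n + k) k)"
    proof (rule Bseq_monoseq_convergent)
      have dec: "decseq (\<lambda>n. cont_frac T (n + k) k)"
        using cont_frac_Suc_less[of T k] l pos k by (intro decseq_SucI) (simp add: less_imp_le)
      then show "monoseq (\<lambda>n. cont_frac T (n + k) k)"
        by (rule decseq_imp_monoseq)
      have "\<bar>cont_frac T (n + k) k\<bar> \<le> cont_frac T (0 + k) k" for n
        using decseqD[OF dec, of 0 n] pos[of k "n + k"] k by simp
      then show "Bseq (\<lambda>n. cont_frac T (n + k) k)"
        by (intro BseqI'[of _ "cont_frac T (0 + k) k"]) simp
    qed
    then show ?thesis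
      unfolding convergent_def by (auto dest: LIMSEQ_offset)
  qed
  then obtain \<kappa> where lim: "\<And>k. k \<ge> 1 \<Longrightarrow> (\<lambda>n. cont_frac T n k) \<longlonglongrightarrow> \<kappa> k"
    by metis
  have nonneg: "\<kappa> k \<ge> 0" if "k \<ge> 1" for k
    using lim[OF that] by (rule LIMSEQ_le_const) (use pos that in \<open>auto intro: less_imp_le exI[of _ k]\<close>)
  have gt: "\<kappa> (Suc k) > 0" if k: "k \<ge> 1" for k
  proof -
    have m: "gb_m T k > 0"
      using pos[of k k] k by (simp add: cont_frac_last)
    have lk: "gb_l T (Suc k) > 0"
      using l k by simp
    \<comment> \<open>Positivity one level further out bounds the tail below independently of
      \<open>n\<close>, so the bound survives the limit.\<close>
    have "gb_l T (Suc k) / gb_m T k \<le> cont_frac T n (Suc k)" if n: "n \<ge> Suc k" for n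
    proof -
      have "cont_frac T n k > 0" "cont_frac T n (Suc k) > 0"
        using pos n k by auto
      then show ?thesis
        using m n by (simp add: cont_frac_rec field_simps)
    qed
    then have "gb_l T (Suc k) / gb_m T k \<le> \<kappa> (Suc k)"
      using lim[of "Suc k"] by (intro LIMSEQ_le_const) auto
    then show ?thesis
      using m lk by (smt (verit) divide_pos_pos)
  qed
  have "\<kappa> k = gb_m T k - gb_l T (Suc k) / \<kappa> (Suc k)" if k: "k \<ge> 1" for k
  proof (rule LIMSEQ_unique[OF lim[OF k]])
    have "(\<lambda>n. gb_m T k - gb_l T (Suc k) / cont_frac T n (Suc k))
        \<longlonglongrightarrow> gb_m T k - gb_l T (Suc k) / \<kappa> (Suc k)"
      using gt[OF k] by (intro tendsto_intros lim) auto
    moreover have "\<forall>\<^sub>F n in sequentially.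
        gb_m T k - gb_l T (Suc k) / cont_frac T n (Suc k) = cont_frac T n k"
      using eventually_gt_at_top[of k] by eventually_elim (simp add: cont_frac_rec)
    ultimately show "(\<lambda>n. cont_frac T n k) \<longlonglongrightarrow> gb_m T k - gb_l T (Suc k) / \<kappa> (Suc k)"
      by (rule Lim_transform_eventually)
  qed
  moreover have "\<kappa> k > 0" if "k \<ge> 2" for k
    using gt[of "k - 1"] that by simp
  ultimately show ?thesis
    using lim nonneg that by blast
qed

text \<open>The limits \<open>\<kappa> k\<close> of the tails of the continued fraction are the subdiagonal of the first
  bidiagonal factor: \<open>x (k - 1) = \<kappa> k\<close>, and \<open>y (k - 1)\<close> is the correction term in
  \<open>\<kappa> k = m k - l (k + 1) / \<kappa> (k + 1)\<close>.\<close>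

lemma limit_bidiagonal_factors:
  assumes l: "\<And>n. n \<ge> 2 \<Longrightarrow> gb_l T n > 0"
    and pos: "\<And>n k. 1 \<le> k \<Longrightarrow> k \<le> n \<Longrightarrow> cont_frac T n k > 0"
  obtains x y where "(\<lambda>n. cont_frac T n 1) \<longlonglongrightarrow> inf_cont_frac T"
    "x 0 = inf_cont_frac T" "x 0 \<ge> 0" "\<And>j. j \<ge> 1 \<Longrightarrow> x j > 0" "\<And>j. y j > 0"
    "\<And>n. n \<ge> 1 \<Longrightarrow> gb_m T n = x (n - 1) + y (n - 1)"
    "\<And>n. n \<ge> 2 \<Longrightarrow> gb_l T n = x (n - 1) * y (n - 2)"
proof -
  obtain \<kappa> where lim: "\<And>k. k \<ge> 1 \<Longrightarrow> (\<lambda>n. cont_frac T n k) \<longlonglongrightarrow> \<kappa> k"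
    and nonneg: "\<And>k. k \<ge> 1 \<Longrightarrow> \<kappa> k \<ge> 0" and gt: "\<And>k. k \<ge> 2 \<Longrightarrow> \<kappa> k > 0"
    and rec: "\<And>k. k \<ge> 1 \<Longrightarrow> \<kappa> k = gb_m T k - gb_l T (Suc k) / \<kappa> (Suc k)"
    using cont_frac_limits[OF l pos] by metis
  have "inf_cont_frac T = \<kappa> 1"
    unfolding inf_cont_frac_def using lim[of 1] by (intro limI) simp
  moreover have "gb_l T n = \<kappa> (Suc (n - 1)) * (gb_l T (n - 2 + 2) / \<kappa> (n - 2 + 2))" if "n \<ge> 2" for n
  proof -
    have "n - 2 + 2 = n" "Suc (n - 1) = n"
      using that by auto
    then show ?thesis
      using gt[OF that] by simp
  qed
  moreover have "gb_m T n = \<kappa> (Suc (n - 1)) + gb_l T (n - 1 + 2) / \<kappa> (n - 1 + 2)" if "n \<ge> 1" for n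
  proof -
    have "n - 1 + 2 = Suc n" "Suc (n - 1) = n"
      using that by auto
    then show ?thesis
      using rec[OF that] by simp
  qed
  moreover have "(\<lambda>n. cont_frac T n 1) \<longlonglongrightarrow> \<kappa> 1" "\<kappa> (Suc 0) = \<kappa> 1" "\<kappa> (Suc 0) \<ge> 0"
    using lim[of 1] nonneg[of 1] by auto
  moreover have "\<kappa> (Suc j) > 0" if "j \<ge> 1" for j
    using gt[of "Suc j"] that by simp
  moreover have "gb_l T (j + 2) / \<kappa> (j + 2) > 0" for j
    using gt l by simp
  ultimately show ?thesis
    using that[of "\<lambda>j. \<kappa> (Suc j)" "\<lambda>j. gb_l T (j + 2) / \<kappa> (j + 2)"] by presburger
qed

section \<open>Matrices with a PBF and multiplication by \<open>E12 s\<close>\<close>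

lemma E12_mult_bidiagonal:
  assumes "T = lower_tridiag m l \<odot> upper_bidiag d"
    and "\<And>n. n \<ge> 1 \<Longrightarrow> m n = x (n - 1) + y (n - 1)"
    and "\<And>n. n \<ge> 2 \<Longrightarrow> l n = x (n - 1) * y (n - 2)"
  shows "E12 s \<odot> T = lower_bidiag (x(0 := x 0 + s)) \<odot> lower_bidiag y \<odot> upper_bidiag d"
proof -
  have "lower_bidiag (x(0 := x 0 + s)) \<odot> lower_bidiag y = lower_tridiag (m(1 := m 1 + s)) l"
    by (rule lower_bidiag_mult_lower_bidiag) (auto simp: assms)
  then show ?thesis
    by (simp add: assms(1) E12_mult_lower_tridiag)
qed

text \<open>By uniqueness, \<open>gb_m\<close> and \<open>gb_l\<close> are sums and products of the
  PBF parameters. If a tail exceeds \<open>x k\<close>, the subtracted quotient is below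
  \<open>y (k - 1)\<close>, so the next fraction exceeds \<open>x (k - 1)\<close>. This bound is
  uniform in \<open>n\<close> and later makes the limit positive.\<close>

lemma has_PBF_gauss_borel:
  assumes "has_PBF T"
  shows has_PBF_leading_minor_pos: "leading_minor T n > 0"
    and has_PBF_eq_lower_upper:
      "T = lower_tridiag (gb_m T) (gb_l T) \<odot> upper_bidiag (gb_diag T)"
    and has_PBF_gb_l_pos: "n \<ge> 2 \<Longrightarrow> gb_l T n > 0"
    and has_PBF_cont_frac_bound:
      "\<exists>x. (\<forall>j. x j > 0) \<and> (\<forall>n k. 1 \<le> k \<longrightarrow> k \<le> n \<longrightarrow> cont_frac T n k > x (k - 1))"
proof -
  obtain x y d where pos: "\<And>j. x j > 0" "\<And>j. y j > 0" "\<And>j. d j > 0"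
    and T: "T = lower_bidiag x \<odot> lower_bidiag y \<odot> upper_bidiag d"
    using has_PBF_E[OF assms] by metis
  define m where "m n = x (n - 1) + y (n - 1)" for n
  define l where "l n = x (n - 1) * y (n - 2)" for n
  have TLU: "T = lower_tridiag m l \<odot> upper_bidiag d"
    unfolding T by (subst lower_bidiag_mult_lower_bidiag[of m x y l]) (auto simp: m_def l_def)
  have lm: "leading_minor T n > 0" for n
    unfolding leading_minor_lower_upper[OF TLU] using pos by (intro prod_pos) auto
  then have nz: "leading_minor T n \<noteq> 0" for n
    using less_irrefl by metis
  note u = gauss_borel_unique[OF nz TLU]
  show "leading_minor T n > 0"
    by (rule lm)
  have "lower_tridiag m l = lower_tridiag (gb_m T) (gb_l T)"
    by (intro ext) (auto simp: lower_tridiag_def u)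
  moreover have "d = gb_diag T"
    by (intro ext u)
  ultimately show "T = lower_tridiag (gb_m T) (gb_l T) \<odot> upper_bidiag (gb_diag T)"
    using TLU by metis
  show "n \<ge> 2 \<Longrightarrow> gb_l T n > 0"
    using pos by (simp flip: u(3) add: l_def)
  have "cont_frac T n k > x (k - 1)" if "1 \<le> k" "k \<le> n" for n k
    using that(2,1)
  proof (induction rule: inc_induct)
    case base
    then show ?case
      using pos by (simp add: cont_frac_last flip: u(2)) (simp add: m_def)
  next
    case (step k)
    have "cont_frac T n (Suc k) > x k"
      using step by simp
    then have "x k * y (k - 1) / cont_frac T n (Suc k) < y (k - 1)"
      using pos[of k] pos(2)[of "k - 1"] by (simp add: field_simps)
    moreover have "gb_m T k = x (k - 1) + y (k - 1)" "gb_l T (Suc k) = x k * y (k - 1)"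
      using u(2)[of k] u(3)[of "Suc k"] step(3) \<open>1 \<le> k\<close> by (auto simp: m_def l_def)
    ultimately show ?case
      using step by (simp add: cont_frac_rec)
  qed
  then show "\<exists>x. (\<forall>j. x j > 0) \<and> (\<forall>n k. 1 \<le> k \<longrightarrow> k \<le> n \<longrightarrow> cont_frac T n k > x (k - 1))"
    using pos by blast
qed

lemma has_PBF_inf_cont_frac_pos:
  assumes "has_PBF T"
  shows "inf_cont_frac T > 0"
proof -
  obtain x where x: "\<And>j. x j > 0" "\<And>n k. 1 \<le> k \<Longrightarrow> k \<le> n \<Longrightarrow> cont_frac T n k > x (k - 1)"
    using has_PBF_cont_frac_bound[OF assms] by metis
  have pos: "cont_frac T n k > 0" if "1 \<le> k" "k \<le> n" for n k
    using x(1)[of "k - 1"] x(2)[OF that] by linarith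
  have "(\<lambda>n. cont_frac T n 1) \<longlonglongrightarrow> inf_cont_frac T"
    using limit_bidiagonal_factors[OF has_PBF_gb_l_pos[OF assms] pos] by metis
  then have "x 0 \<le> inf_cont_frac T"
    using x(2)[of 1] by (intro LIMSEQ_le_const) (auto intro!: exI[of _ 1] less_imp_le)
  then show ?thesis
    using x(1)[of 0] by linarith
qed

text \<open>The leading minors are products of the diagonal of the upper factor and do not change,
  so uniqueness applies to the new factors. Only \<open>gb_m\<close> at 1 differs, and it enters
  \<open>cont_frac T n 1\<close> as the outermost summand.\<close>

lemma inf_cont_frac_E12_mult:
  assumes T: "T = lower_tridiag (gb_m T) (gb_l T) \<odot> upper_bidiag (gb_diag T)"
    and nz: "\<And>n. leading_minor T n \<noteq> 0"
    and lim: "(\<lambda>n. cont_frac T n 1) \<longlonglongrightarrow> inf_cont_frac T"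
  shows "inf_cont_frac (E12 s \<odot> T) = inf_cont_frac T + s"
proof -
  define T' where "T' = E12 s \<odot> T"
  have T': "T' = lower_tridiag ((gb_m T)(1 := gb_m T 1 + s)) (gb_l T) \<odot> upper_bidiag (gb_diag T)"
    unfolding T'_def by (subst T) (rule E12_mult_lower_tridiag)
  have "leading_minor T' n = leading_minor T n" for n
    unfolding leading_minor_lower_upper[OF T] leading_minor_lower_upper[OF T'] ..
  then have nz': "leading_minor T' n \<noteq> 0" for n
    using nz by simp
  note u = gauss_borel_unique[OF nz' T']
  have "cont_frac T' n k = cont_frac T n k" if "2 \<le> k" "k \<le> n" for n k
    using that(2,1)
    by (induction rule: inc_induct) (auto simp: cont_frac_last cont_frac_rec simp flip: u(2,3))
  moreover have "gb_m T' 1 = gb_m T 1 + s" "gb_l T' 2 = gb_l T 2"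
    using u(2)[of 1] u(3)[of 2] by auto
  ultimately have "cont_frac T n 1 + s = cont_frac T' n 1" if "n \<ge> 2" for n
    using that by (simp add: cont_frac_rec numeral_2_eq_2)
  then have "(\<lambda>n. cont_frac T' n 1) \<longlonglongrightarrow> inf_cont_frac T + s"
    using lim by (intro Lim_transform_eventually[OF tendsto_add[OF lim tendsto_const]])
      (auto simp: eventually_sequentially)
  then show ?thesis
    unfolding inf_cont_frac_def[of "E12 s \<odot> T"] T'_def by (rule limI)
qed

section \<open>Minors of products with bidiagonal matrices\<close>

text \<open>Index sequences replace index sets because the multilinear expansion of a product
  produces repeated columns.\<close>

definition minor :: "inf_mat \<Rightarrow> nat \<Rightarrow> (nat \<Rightarrow> nat) \<Rightarrow> (nat \<Rightarrow> nat) \<Rightarrow> real" where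
  "minor F k r c = det (mat k k (\<lambda>(i, j). F (r i) (c j)))"

definition inf_totally_nonneg :: "inf_mat \<Rightarrow> bool" where
  "inf_totally_nonneg F \<longleftrightarrow>
     (\<forall>k r c. strict_mono_on {..<k} r \<longrightarrow> strict_mono_on {..<k} c \<longrightarrow> minor F k r c \<ge> 0)"

text \<open>Models right multiplication by a bidiagonal matrix, with \<open>\<sigma>\<close> the
  neighbouring column: the successor for a lower factor, the predecessor for an upper one.\<close>

definition col_op :: "(nat \<Rightarrow> real) \<Rightarrow> (nat \<Rightarrow> real) \<Rightarrow> (nat \<Rightarrow> nat) \<Rightarrow> inf_mat \<Rightarrow> inf_mat" where
  "col_op p q \<sigma> F = (\<lambda>i j. p j * F i j + q j * F i (\<sigma> j))"

lemma minor_cong: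
  assumes "\<And>i j. i < k \<Longrightarrow> j < k \<Longrightarrow> F (r i) (c j) = F' (r' i) (c' j)"
  shows "minor F k r c = minor F' k r' c'"
  unfolding minor_def by (rule arg_cong[of _ _ det], rule cong_mat) (auto simp: assms)

text \<open>The cofactors along column \<open>t\<close> do not see that column, so Laplace expansion
  along it is linear in its entries.\<close>

lemma det_column_linear:
  fixes a b :: "'a :: comm_ring_1"
  assumes t: "t < k"
  shows "det (mat k k (\<lambda>(i, j). if j = t then a * f i + b * g i else h i j))
       = a * det (mat k k (\<lambda>(i, j). if j = t then f i else h i j))
         + b * det (mat k k (\<lambda>(i, j). if j = t then g i else h i j))"
proof -
  define M where "M f = mat k k (\<lambda>(i, j). if j = t then f i else h i j)" for f :: "nat \<Rightarrow> 'a"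
  have M: "M f \<in> carrier_mat k k" for f
    by (simp add: M_def)
  have entry: "M f $$ (i, t) = f i" if "i < k" for f i
    using that t by (simp add: M_def)
  have cof: "cofactor (M f) i t = cofactor (M g) i t" if "i < k" for f g i
    unfolding cofactor_def mat_delete_def
    by (intro arg_cong2[where f = "(*)"] refl arg_cong[of _ _ det] cong_mat) (use that t in \<open>auto simp: M_def\<close>)
  have det: "det (M f) = (\<Sum>i<k. f i * cofactor (M (\<lambda>_. 0)) i t)" for f
    unfolding laplace_expansion_column[OF M t]
    using cof[of _ f "\<lambda>_. 0"] by (intro sum.cong) (auto simp: entry)
  have "det (M (\<lambda>i. a * f i + b * g i)) = a * det (M f) + b * det (M g)"
    unfolding det by (simp add: sum_distrib_left sum.distrib algebra_simps)
  then show ?thesis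
    by (simp add: M_def)
qed

lemma minor_weakly_increasing_nonneg:
  assumes F: "inf_totally_nonneg F"
    and r: "strict_mono_on {..<k} r"
    and c: "\<And>i j. i < j \<Longrightarrow> j < k \<Longrightarrow> c i \<le> c j"
  shows "minor F k r c \<ge> 0"
proof (cases "strict_mono_on {..<k} c")
  case True
  then show ?thesis
    using F r unfolding inf_totally_nonneg_def by blast
next
  case False
  then obtain i j where ij: "i < j" "j < k" "\<not> c i < c j"
    unfolding strict_mono_on_def by auto
  then have eq: "c i = c j"
    using c[of i j] by simp
  have "minor F k r c = 0"
    unfolding minor_def
    by (rule det_identical_columns[of _ k i j]) (use ij eq in \<open>auto intro!: eq_vecI\<close>)
  then show ?thesis by simp
qed

text \<open>Expanding the columns one after the other, every term of the multilinear expansion is a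
  minor with weakly increasing columns, so the whole dominates any single term.\<close>

lemma minor_col_op_ge:
  assumes F: "inf_totally_nonneg F"
    and p: "\<And>j. p j \<ge> 0" and q: "\<And>j. q j \<ge> 0"
    and \<sigma>: "\<And>i j. i < j \<Longrightarrow> i \<le> \<sigma> j" "\<And>i j. i < j \<Longrightarrow> \<sigma> i \<le> j" "\<And>i j. i < j \<Longrightarrow> \<sigma> i \<le> \<sigma> j"
    and r: "strict_mono_on {..<k} r" and c: "strict_mono_on {..<k} c"
  shows "minor (col_op p q \<sigma> F) k r c
    \<ge> (\<Prod>j<k. if \<chi> j then q (c j) else p (c j))
      * minor F k r (\<lambda>j. if \<chi> j then \<sigma> (c j) else c j)"
    (is "_ \<ge> (\<Prod>j<k. ?w j) * minor F k r ?e")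
proof -
  \<comment> \<open>A hybrid determinant: the first \<open>t\<close> columns come from the product,
    the others are columns of \<open>F\<close> selected by \<open>c'\<close>.\<close>
  define D where "D t c' = det (mat k k (\<lambda>(i, j).
      if j < t then col_op p q \<sigma> F (r i) (c j) else F (r i) (c' j)))" for t c'
  define adm where "adm c' \<longleftrightarrow> (\<forall>j<k. c' j = c j \<or> c' j = \<sigma> (c j))" for c'
  have D0: "D 0 c' = minor F k r c'" for c'
    by (simp add: D_def minor_def)
  have D0_nonneg: "D 0 c' \<ge> 0" if "adm c'" for c'
    unfolding D0
  proof (rule minor_weakly_increasing_nonneg[OF F r])
    fix i j assume ij: "i < j" "j < k"
    then have "c i < c j"
      using c by (auto simp: strict_mono_on_def)
    moreover have "c' i = c i \<or> c' i = \<sigma> (c i)" "c' j = c j \<or> c' j = \<sigma> (c j)"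
      using that ij by (auto simp: adm_def)
    ultimately show "c' i \<le> c' j"
      using \<sigma>[of "c i" "c j"] by auto
  qed
  have w: "?w j \<ge> 0" for j
    using p q by simp
  have main: "D t c' \<ge> (\<Prod>j<t. ?w j) * D 0 (\<lambda>j. if j < t then ?e j else c' j)"
    if "t \<le> k" "adm c'" for t c'
    using that
  proof (induction t arbitrary: c')
    case 0
    then show ?case by simp
  next
    case (Suc t)
    define D' where "D' = (\<lambda>a. D t (c'(t := a)))"
    have "D (Suc t) c' = det (mat k k (\<lambda>(i, j). if j = t
        then p (c t) * F (r i) (c t) + q (c t) * F (r i) (\<sigma> (c t))
        else if j < t then col_op p q \<sigma> F (r i) (c j) else F (r i) (c' j)))"
      unfolding D_def by (rule arg_cong[of _ _ det], rule cong_mat) (auto simp: col_op_def)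
    also have "\<dots> = p (c t) * det (mat k k (\<lambda>(i, j). if j = t then F (r i) (c t)
          else if j < t then col_op p q \<sigma> F (r i) (c j) else F (r i) (c' j)))
        + q (c t) * det (mat k k (\<lambda>(i, j). if j = t then F (r i) (\<sigma> (c t))
          else if j < t then col_op p q \<sigma> F (r i) (c j) else F (r i) (c' j)))"
      by (rule det_column_linear) (use Suc in auto)
    also have "\<dots> = p (c t) * D' (c t) + q (c t) * D' (\<sigma> (c t))"
      unfolding D_def D'_def
      by (intro arg_cong2[where f = "(+)"] arg_cong2[where f = "(*)"] refl
          arg_cong[of _ _ det] cong_mat) auto
    finally have expand: "D (Suc t) c' = p (c t) * D' (c t) + q (c t) * D' (\<sigma> (c t))" .
    have IH: "D' a \<ge> (\<Prod>j<t. ?w j) * D 0 (\<lambda>j. if j < t then ?e j else (c'(t := a)) j)"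
      and nonneg: "D' a \<ge> 0" if "a = c t \<or> a = \<sigma> (c t)" for a
    proof -
      have "adm (c'(t := a))"
        using Suc.prems that by (auto simp: adm_def)
      then show *: "D' a \<ge> (\<Prod>j<t. ?w j) * D 0 (\<lambda>j. if j < t then ?e j else (c'(t := a)) j)"
        unfolding D'_def using Suc by simp
      have "D 0 (\<lambda>j. if j < t then ?e j else (c'(t := a)) j) \<ge> 0"
        using \<open>adm (c'(t := a))\<close> by (intro D0_nonneg) (auto simp: adm_def)
      then show "D' a \<ge> 0"
        using * w by (smt (verit) mult_nonneg_nonneg prod_nonneg)
    qed
    have e: "?e t = c t \<or> ?e t = \<sigma> (c t)"
      by simp
    have "(\<lambda>j. if j < t then ?e j else (c'(t := ?e t)) j) = (\<lambda>j. if j < Suc t then ?e j else c' j)"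
      by (auto simp: fun_eq_iff less_Suc_eq)
    then have "(\<Prod>j<Suc t. ?w j) * D 0 (\<lambda>j. if j < Suc t then ?e j else c' j)
        = ?w t * ((\<Prod>j<t. ?w j) * D 0 (\<lambda>j. if j < t then ?e j else (c'(t := ?e t)) j))"
      by (simp add: mult_ac)
    also have "\<dots> \<le> ?w t * D' (?e t)"
      by (intro mult_left_mono IH e w)
    also have "\<dots> \<le> D (Suc t) c'"
      unfolding expand using nonneg p q by auto
    finally show ?case .
  qed
  have "D k c = minor (col_op p q \<sigma> F) k r c"
    unfolding D_def minor_def by (rule arg_cong[of _ _ det], rule cong_mat) auto
  moreover have "D 0 (\<lambda>j. if j < k then ?e j else c j) = minor F k r ?e"
    unfolding D0 by (rule minor_cong) auto
  ultimately show ?thesis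
    using main[of k c] by (simp add: adm_def)
qed

lemma inf_totally_nonneg_col_op:
  assumes F: "inf_totally_nonneg F"
    and p: "\<And>j. p j \<ge> 0" and q: "\<And>j. q j \<ge> 0"
    and \<sigma>: "\<And>i j. i < j \<Longrightarrow> i \<le> \<sigma> j" "\<And>i j. i < j \<Longrightarrow> \<sigma> i \<le> j" "\<And>i j. i < j \<Longrightarrow> \<sigma> i \<le> \<sigma> j"
  shows "inf_totally_nonneg (col_op p q \<sigma> F)"
  unfolding inf_totally_nonneg_def
proof (intro allI impI)
  fix k r c assume rc: "strict_mono_on {..<k::nat} (r::nat \<Rightarrow> nat)" "strict_mono_on {..<k} (c::nat \<Rightarrow> nat)"
  then have "minor F k r c \<ge> 0"
    using F by (auto simp: inf_totally_nonneg_def)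
  then have "0 \<le> (\<Prod>j<k. p (c j)) * minor F k r c"
    using p by (simp add: prod_nonneg)
  also have "\<dots> \<le> minor (col_op p q \<sigma> F) k r c"
    using minor_col_op_ge[OF F p q \<sigma> rc, where \<chi> = "\<lambda>_. False"] by simp
  finally show "minor (col_op p q \<sigma> F) k r c \<ge> 0" .
qed

lemma minor_col_op_pos:
  assumes F: "inf_totally_nonneg F"
    and p: "\<And>j. p j \<ge> 0" and q: "\<And>j. q j \<ge> 0"
    and \<sigma>: "\<And>i j. i < j \<Longrightarrow> i \<le> \<sigma> j" "\<And>i j. i < j \<Longrightarrow> \<sigma> i \<le> j" "\<And>i j. i < j \<Longrightarrow> \<sigma> i \<le> \<sigma> j"
    and rc: "strict_mono_on {..<k} r" "strict_mono_on {..<k} c"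
    and pos: "minor F k r c' > 0"
    and c': "\<And>j. j < k \<Longrightarrow> c' j = c j \<and> p (c j) > 0 \<or> c' j = \<sigma> (c j) \<and> q (c j) > 0"
  shows "minor (col_op p q \<sigma> F) k r c > 0"
proof -
  \<comment> \<open>Stay in place whenever that has positive weight; otherwise the hypothesis
    supplies a move of positive weight.\<close>
  define \<chi> where "\<chi> j \<longleftrightarrow> \<not> (c' j = c j \<and> p (c j) > 0)" for j
  have "minor F k r (\<lambda>j. if \<chi> j then \<sigma> (c j) else c j) = minor F k r c'"
    by (rule minor_cong) (use c' in \<open>force simp: \<chi>_def\<close>)
  moreover have "(\<Prod>j<k. if \<chi> j then q (c j) else p (c j)) > 0"
    by (rule prod_pos) (use c' in \<open>force simp: \<chi>_def\<close>)
  ultimately have "0 < (\<Prod>j<k. if \<chi> j then q (c j) else p (c j))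
      * minor F k r (\<lambda>j. if \<chi> j then \<sigma> (c j) else c j)"
    using pos by simp
  also have "\<dots> \<le> minor (col_op p q \<sigma> F) k r c"
    by (rule minor_col_op_ge[OF F p q \<sigma> rc])
  finally show ?thesis .
qed

section \<open>Total nonnegativity of the identity\<close>

definition inf_id :: inf_mat where
  "inf_id = (\<lambda>i j. if i = j then 1 else 0)"

lemma minor_inf_id_same:
  assumes "strict_mono_on {..<k} r"
  shows "minor inf_id k r r = 1"
proof -
  have "mat k k (\<lambda>(i, j). inf_id (r i) (r j)) = 1\<^sub>m k"
    using strict_mono_on_imp_inj_on[OF assms] by (intro eq_matI) (auto simp: inf_id_def inj_on_eq_iff)
  then show ?thesis
    by (simp add: minor_def)
qed

lemma det_zero_row:
  assumes "A \<in> carrier_mat n n" "i < n" "\<And>j. j < n \<Longrightarrow> A $$ (i, j) = 0"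
  shows "det A = 0"
  unfolding laplace_expansion_row[OF assms(1,2)] by (rule sum.neutral) (use assms(3) in auto)

lemma det_zero_column:
  assumes "A \<in> carrier_mat n n" "j < n" "\<And>i. i < n \<Longrightarrow> A $$ (i, j) = 0"
  shows "det A = 0"
  unfolding laplace_expansion_column[OF assms(1,2)] by (rule sum.neutral) (use assms(3) in auto)

text \<open>If two increasing sequences differ, the smaller of the two values at the first difference is
  missing from the other sequence, which gives a zero row or column.\<close>

lemma first_difference_missing:
  assumes r: "strict_mono_on {..<k} (r :: nat \<Rightarrow> nat)" and c: "strict_mono_on {..<k} c"
    and p: "p < k" "\<And>q. q < p \<Longrightarrow> r q = c q" "r p < c p" and j: "j < k"
  shows "r p \<noteq> c j"
proof (cases "j < p")
  case True
  then have "r j < r p"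
    using r p(1) j by (auto simp: strict_mono_on_def)
  then show ?thesis
    using p(2)[OF True] by simp
next
  case False
  then have "c p \<le> c j"
    using c p(1) j by (cases "p = j") (auto simp: strict_mono_on_def intro: less_imp_le)
  then show ?thesis
    using p(3) by simp
qed

lemma inf_totally_nonneg_inf_id: "inf_totally_nonneg inf_id"
  unfolding inf_totally_nonneg_def
proof (intro allI impI)
  fix k and r c :: "nat \<Rightarrow> nat"
  assume r: "strict_mono_on {..<k} r" and c: "strict_mono_on {..<k} c"
  show "minor inf_id k r c \<ge> 0"
  proof (cases "\<forall>p<k. r p = c p")
    case True
    then have "minor inf_id k r c = minor inf_id k r r"
      by (intro minor_cong) auto
    then show ?thesis
      using minor_inf_id_same[OF r] by simp
  next
    case False
    then have "\<exists>p. p < k \<and> r p \<noteq> c p" by auto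
    then obtain p where p: "p < k" "r p \<noteq> c p" and "\<forall>q<p. \<not> (q < k \<and> r q \<noteq> c q)"
      using exists_least_iff[of "\<lambda>p. p < k \<and> r p \<noteq> c p"] by auto
    then have first: "\<And>q. q < p \<Longrightarrow> r q = c q"
      by auto
    have "minor inf_id k r c = 0"
    proof (cases "r p < c p")
      case True
      then show ?thesis
        unfolding minor_def
        by (intro det_zero_row[of _ k p])
          (use p first_difference_missing[OF r c p(1) first] in \<open>auto simp: inf_id_def\<close>)
    next
      case False
      then have "c p < r p"
        using p by simp
      then have "r i \<noteq> c p" if "i < k" for i
        using first_difference_missing[OF c r p(1) first[symmetric] _ that] by fastforce
      then show ?thesis
        unfolding minor_def
        by (intro det_zero_column[of _ k p]) (use p in \<open>auto simp: inf_id_def\<close>)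
    qed
    then show ?thesis by simp
  qed
qed

section \<open>Truncated bidiagonal factors and minors given by index sets\<close>

lemma mult_truncation_lower_bidiag:
  assumes A: "A \<in> carrier_mat (Suc N) (Suc N)" and ij: "i \<le> N" "j \<le> N"
  shows "(A * truncation (lower_bidiag x) N) $$ (i, j)
    = A $$ (i, j) + (if j < N then x j * A $$ (i, Suc j) else 0)"
proof -
  have "(A * truncation (lower_bidiag x) N) $$ (i, j)
      = (\<Sum>k\<in>{0..<Suc N}. A $$ (i, k) * lower_bidiag x k j)"
    using A ij by (simp add: truncation_def scalar_prod_def)
  also have "\<dots> = (\<Sum>k\<in>{j, Suc j} \<inter> {..N}. A $$ (i, k) * lower_bidiag x k j)"
    by (rule sum.mono_neutral_right) (use ij in \<open>auto simp: lower_bidiag_def\<close>)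
  also have "\<dots> = A $$ (i, j) + (if j < N then x j * A $$ (i, Suc j) else 0)"
  proof (cases "j < N")
    case True
    then have "{j, Suc j} \<inter> {..N} = {j, Suc j}" by auto
    then show ?thesis using True by (simp add: lower_bidiag_def)
  next
    case False
    then have "{j, Suc j} \<inter> {..N} = {j}" using ij by auto
    then show ?thesis using False by (simp add: lower_bidiag_def)
  qed
  finally show ?thesis .
qed

lemma mult_truncation_upper_bidiag:
  assumes A: "A \<in> carrier_mat (Suc N) (Suc N)" and ij: "i \<le> N" "j \<le> N"
  shows "(A * truncation (upper_bidiag d) N) $$ (i, j)
    = d j * A $$ (i, j) + (if j = 0 then 0 else A $$ (i, j - 1))"
proof -
  have "(A * truncation (upper_bidiag d) N) $$ (i, j)
      = (\<Sum>k\<in>{0..<Suc N}. A $$ (i, k) * upper_bidiag d k j)"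
    using A ij by (simp add: truncation_def scalar_prod_def)
  also have "\<dots> = (\<Sum>k\<in>{j, j - 1}. A $$ (i, k) * upper_bidiag d k j)"
    by (rule sum.mono_neutral_right) (use ij in \<open>auto simp: upper_bidiag_def\<close>)
  finally show ?thesis
    by (cases j) (auto simp: upper_bidiag_def)
qed

lemma pick_less:
  assumes "I \<subseteq> {..<n}" "i < card I"
  shows "pick I i < n"
  using pick_in_set_le[OF assms(2)] assms(1) by auto

lemma det_submatrix_eq_minor:
  assumes A: "A \<in> carrier_mat n n"
    and F: "\<And>i j. i < n \<Longrightarrow> j < n \<Longrightarrow> A $$ (i, j) = F i j"
    and IJ: "I \<subseteq> {..<n}" "J \<subseteq> {..<n}" "card I = card J"
  shows "det (submatrix A I J) = minor F (card I) (pick I) (pick J)"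
proof -
  have "{i. i < n \<and> i \<in> I} = I" "{i. i < n \<and> i \<in> J} = J"
    using IJ by auto
  moreover have "pick I i < n" "pick J i < n" if "i < card I" for i
    using pick_less[OF IJ(1)] pick_less[OF IJ(2)] that IJ(3) by auto
  ultimately show ?thesis
    unfolding submatrix_def minor_def using A IJ
    by (intro arg_cong[of _ _ det]) (auto intro!: cong_mat F)
qed

lemma strict_mono_on_pick: "strict_mono_on {..<card I} (pick I)"
  by (auto simp: strict_mono_on_def intro: pick_mono_le)

lemma strict_mono_on_ge:
  assumes "strict_mono_on {..<k} (r :: nat \<Rightarrow> nat)" "j < k"
  shows "j \<le> r j"
  using assms(2)
proof (induction j)
  case (Suc j)
  then have "r j < r (Suc j)"
    using assms(1) by (auto simp: strict_mono_on_def)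
  then show ?case using Suc by simp
qed simp

text \<open>These sequences interpolate between \<open>r\<close> and 0, ..., k - 1: each index moves
  down by \<open>t\<close> but stops at its final position \<open>j\<close>.\<close>

lemma strict_mono_on_max_diff:
  assumes "strict_mono_on {..<k} (r :: nat \<Rightarrow> nat)"
  shows "strict_mono_on {..<k} (\<lambda>j. max j (r j - t))"
  unfolding strict_mono_on_def
proof (intro allI impI)
  fix i j assume "i \<in> {..<k} \<and> j \<in> {..<k} \<and> i < j"
  moreover from this have "r i < r j"
    using assms by (auto simp: strict_mono_on_def)
  ultimately show "max i (r i - t) < max j (r j - t)"
    by auto
qed

section \<open>Total positivity of a power of the truncated bidiagonal product\<close>

context
  fixes x y d :: "nat \<Rightarrow> real" and N :: nat
  assumes x: "\<And>j. x j \<ge> 0" and y: "\<And>j. y j > 0" and d: "\<And>j. d j > 0"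
begin

text \<open>The last column of the truncation has no neighbour to its right, hence the weight 0 from
  \<open>N\<close> on.\<close>

definition lower_op :: "(nat \<Rightarrow> real) \<Rightarrow> inf_mat \<Rightarrow> inf_mat" where
  "lower_op z = col_op (\<lambda>_. 1) (\<lambda>j. if j < N then z j else 0) Suc"

text \<open>At column 0 the predecessor \<open>0 - 1\<close> is 0 itself; the weight 0 removes this
  spurious term.\<close>

definition upper_op :: "inf_mat \<Rightarrow> inf_mat" where
  "upper_op = col_op d (\<lambda>j. if j = 0 then 0 else 1) (\<lambda>j. j - 1)"

definition bidiag_op :: "inf_mat \<Rightarrow> inf_mat" where
  "bidiag_op F = upper_op (lower_op y (lower_op x F))"

lemma inf_totally_nonneg_lower_op:
  "inf_totally_nonneg F \<Longrightarrow> (\<And>j. z j \<ge> 0) \<Longrightarrow> inf_totally_nonneg (lower_op z F)"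
  unfolding lower_op_def by (rule inf_totally_nonneg_col_op) auto

lemma inf_totally_nonneg_bidiag_op:
  assumes "inf_totally_nonneg F"
  shows "inf_totally_nonneg (bidiag_op F)"
  unfolding bidiag_op_def upper_op_def
  by (intro inf_totally_nonneg_col_op inf_totally_nonneg_lower_op assms)
    (use x y d in \<open>auto intro: less_imp_le\<close>)

lemma minor_lower_op_pos:
  assumes "inf_totally_nonneg F" "strict_mono_on {..<k} r" "strict_mono_on {..<k} c"
    and "minor F k r c' > 0" and "\<And>j. z j \<ge> 0"
    and "\<And>j. j < k \<Longrightarrow> c' j = c j \<or> c' j = Suc (c j) \<and> c j < N \<and> z (c j) > 0"
  shows "minor (lower_op z F) k r c > 0"
  unfolding lower_op_def by (rule minor_col_op_pos[OF assms(1) _ _ _ _ _ assms(2,3,4)]) (use assms(5,6) in auto)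

lemma minor_upper_op_pos:
  assumes "inf_totally_nonneg F" "strict_mono_on {..<k} r" "strict_mono_on {..<k} c"
    and "minor F k r c' > 0"
    and "\<And>j. j < k \<Longrightarrow> c' j = c j \<or> Suc (c' j) = c j"
  shows "minor (upper_op F) k r c > 0"
  unfolding upper_op_def
  by (rule minor_col_op_pos[OF assms(1) _ _ _ _ _ assms(2,3,4)])
    (use assms(5) d in \<open>force simp: less_imp_le\<close>)+

text \<open>Columns stay in place in the factor with \<open>x\<close>, whose diagonal is 1, so
  \<open>x\<close> may have zeros. Downward moves use the positive \<open>y\<close>, upward moves
  the ones above the diagonal of the upper factor.\<close>

lemma minor_bidiag_op_pos:
  assumes F: "inf_totally_nonneg F" and rc: "strict_mono_on {..<k} r" "strict_mono_on {..<k} c"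
    and c': "strict_mono_on {..<k} c'" and pos: "minor F k r c' > 0"
    and near: "(\<forall>j<k. c' j = c j \<or> c' j = Suc (c j) \<and> c j < N) \<or> (\<forall>j<k. c' j = c j \<or> Suc (c' j) = c j)"
  shows "minor (bidiag_op F) k r c > 0"
proof -
  define G where "G = lower_op x F"
  have G: "inf_totally_nonneg G"
    unfolding G_def using F x by (rule inf_totally_nonneg_lower_op)
  then have H: "inf_totally_nonneg (lower_op y G)"
    using y by (intro inf_totally_nonneg_lower_op) (auto intro: less_imp_le)
  have posG: "minor G k r c' > 0"
    unfolding G_def by (rule minor_lower_op_pos[OF F rc(1) c' pos]) (use x in auto)
  from near have "minor (upper_op (lower_op y G)) k r c > 0"
  proof
    assume *: "\<forall>j<k. c' j = c j \<or> c' j = Suc (c j) \<and> c j < N"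
    have "minor (lower_op y G) k r c > 0"
      by (rule minor_lower_op_pos[OF G rc posG]) (use * y in \<open>auto intro: less_imp_le\<close>)
    then show ?thesis
      by (rule minor_upper_op_pos[OF H rc]) auto
  next
    assume *: "\<forall>j<k. c' j = c j \<or> Suc (c' j) = c j"
    have "minor (lower_op y G) k r c' > 0"
      by (rule minor_lower_op_pos[OF G rc(1) c' posG]) (use y in \<open>auto intro: less_imp_le\<close>)
    then show ?thesis
      by (rule minor_upper_op_pos[OF H rc]) (use * in auto)
  qed
  then show ?thesis
    by (simp add: bidiag_op_def G_def)
qed

lemma inf_totally_nonneg_bidiag_op_funpow: "inf_totally_nonneg ((bidiag_op ^^ t) inf_id)"
  by (induction t) (auto intro: inf_totally_nonneg_inf_id inf_totally_nonneg_bidiag_op)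

text \<open>Each factor moves every column index by at most one place: the column set is first pushed
  down from \<open>r\<close> to \<open>{0, \<dots>, k - 1}\<close> by the lower factors, and then up to \<open>c\<close> by the upper ones.\<close>

lemma minor_bidiag_op_funpow_pos:
  assumes r: "strict_mono_on {..<k} r" and rN: "\<And>j. j < k \<Longrightarrow> r j \<le> N"
    and c: "strict_mono_on {..<k} c" and cN: "\<And>j. j < k \<Longrightarrow> c j \<le> N"
  shows "minor ((bidiag_op ^^ (N + Suc N)) inf_id) k r c > 0"
proof -
  have down: "minor ((bidiag_op ^^ t) inf_id) k r (\<lambda>j. max j (r j - t)) > 0" for t
  proof (induction t)
    case 0
    have "minor inf_id k r (\<lambda>j. max j (r j - 0)) = minor inf_id k r r"
      by (rule minor_cong) (use strict_mono_on_ge[OF r] in \<open>auto simp: max_absorb2\<close>)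
    then show ?case
      using minor_inf_id_same[OF r] by simp
  next
    case (Suc t)
    have "minor (bidiag_op ((bidiag_op ^^ t) inf_id)) k r (\<lambda>j. max j (r j - Suc t)) > 0"
    proof (rule minor_bidiag_op_pos[OF inf_totally_nonneg_bidiag_op_funpow r
            strict_mono_on_max_diff[OF r] strict_mono_on_max_diff[OF r] Suc], rule disjI1, intro allI impI)
      fix j assume "j < k"
      then show "max j (r j - t) = max j (r j - Suc t)
          \<or> max j (r j - t) = Suc (max j (r j - Suc t)) \<and> max j (r j - Suc t) < N"
        using strict_mono_on_ge[OF r, of j] rN[of j] by linarith
    qed
    then show ?case by simp
  qed
  \<comment> \<open>After \<open>N\<close> steps the columns are 0, ..., k - 1, because all row
    indices are at most \<open>N\<close>. Likewise \<open>max j (c j - N)\<close> is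
    \<open>j\<close>, so the ascent to \<open>c\<close> starts from the same columns.\<close>
  have up: "minor ((bidiag_op ^^ (N + t)) inf_id) k r (\<lambda>j. max j (c j - (N - t))) > 0" for t
  proof (induction t)
    case 0
    have "minor ((bidiag_op ^^ N) inf_id) k r (\<lambda>j. max j (c j - N))
        = minor ((bidiag_op ^^ N) inf_id) k r (\<lambda>j. max j (r j - N))"
      by (rule minor_cong) (use rN cN in auto)
    then show ?case
      using down[of N] by simp
  next
    case (Suc t)
    have "minor (bidiag_op ((bidiag_op ^^ (N + t)) inf_id)) k r (\<lambda>j. max j (c j - (N - Suc t))) > 0"
      by (rule minor_bidiag_op_pos[OF inf_totally_nonneg_bidiag_op_funpow r
            strict_mono_on_max_diff[OF c] strict_mono_on_max_diff[OF c] Suc], rule disjI2, intro allI impI) linarith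
    then show ?case by simp
  qed
  \<comment> \<open>Since \<open>N - Suc N\<close> is 0, the last step leaves the columns in place.
    It makes the exponent positive even for \<open>N = 0\<close>.\<close>
  have "minor ((bidiag_op ^^ (N + Suc N)) inf_id) k r (\<lambda>j. max j (c j - (N - Suc N)))
      = minor ((bidiag_op ^^ (N + Suc N)) inf_id) k r c"
    by (rule minor_cong) (use strict_mono_on_ge[OF c] in \<open>auto simp: max_absorb2\<close>)
  then show ?thesis
    using up[of "Suc N"] by simp
qed

text \<open>Each further power multiplies by the three factors from the right, which applies their
  column operations in turn. The cutoff at \<open>N\<close> keeps columns outside the truncation
  from entering.\<close>

lemma bidiagonal_product_pow:
  defines "A \<equiv> truncation (lower_bidiag x) N * truncation (lower_bidiag y) N
      * truncation (upper_bidiag d) N"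
  assumes "i \<le> N" "j \<le> N"
  shows "(A ^\<^sub>m t) $$ (i, j) = (bidiag_op ^^ t) inf_id i j"
  using assms(2,3)
proof (induction t arbitrary: i j)
  case 0
  then show ?case
    by (simp add: A_def inf_id_def truncation_def)
next
  case (Suc t)
  define L1 L2 U where "L1 = truncation (lower_bidiag x) N" and "L2 = truncation (lower_bidiag y) N"
    and "U = truncation (upper_bidiag d) N"
  define B where "B = A ^\<^sub>m t"
  define F where "F = (bidiag_op ^^ t) inf_id"
  have BF: "B $$ (i, j) = F i j" if "i \<le> N" "j \<le> N" for i j
    using Suc.IH[OF that] by (simp add: B_def F_def)
  have carr: "L1 \<in> carrier_mat (Suc N) (Suc N)" "L2 \<in> carrier_mat (Suc N) (Suc N)"
    "U \<in> carrier_mat (Suc N) (Suc N)" "A \<in> carrier_mat (Suc N) (Suc N)"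
    unfolding L1_def L2_def U_def A_def
    by (intro mult_carrier_mat[of _ _ "Suc N"] truncation_carrier)+
  then have B: "B \<in> carrier_mat (Suc N) (Suc N)"
    unfolding B_def by (intro pow_carrier_mat)
  have "A ^\<^sub>m Suc t = B * (L1 * L2 * U)"
    by (simp add: B_def A_def L1_def L2_def U_def)
  also have "\<dots> = B * L1 * L2 * U"
    using assoc_mult_mat[OF B mult_carrier_mat[OF carr(1,2)] carr(3)] assoc_mult_mat[OF B carr(1,2)]
    by simp
  finally have pow: "A ^\<^sub>m Suc t = B * L1 * L2 * U" .
  have BL: "B * L1 \<in> carrier_mat (Suc N) (Suc N)" "B * L1 * L2 \<in> carrier_mat (Suc N) (Suc N)"
    using B carr by auto
  have e1: "(B * L1) $$ (i, j) = lower_op x F i j" if "i \<le> N" "j \<le> N" for i j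
    using that BF unfolding L1_def mult_truncation_lower_bidiag[OF B that]
    by (auto simp: lower_op_def col_op_def)
  have e2: "(B * L1 * L2) $$ (i, j) = lower_op y (lower_op x F) i j"
    if "i \<le> N" "j \<le> N" for i j
    using that e1 unfolding L2_def mult_truncation_lower_bidiag[OF BL(1) that]
    by (auto simp: lower_op_def[of y] col_op_def)
  have "(A ^\<^sub>m Suc t) $$ (i, j) = bidiag_op F i j"
    using Suc.prems e2 unfolding pow U_def mult_truncation_upper_bidiag[OF BL(2) Suc.prems]
    by (auto simp: bidiag_op_def upper_op_def col_op_def)
  then show ?case
    by (simp only: F_def funpow.simps o_apply)
qed

lemma oscillatory_mat_bidiagonal_product:
  "oscillatory_mat (truncation (lower_bidiag x) N * truncation (lower_bidiag y) N
      * truncation (upper_bidiag d) N)" (is "oscillatory_mat ?A")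
proof -
  have A: "?A \<in> carrier_mat (Suc N) (Suc N)"
    by (intro mult_carrier_mat[of _ _ "Suc N"] truncation_carrier)
  then have At: "?A ^\<^sub>m t \<in> carrier_mat (Suc N) (Suc N)" for t
    by (rule pow_carrier_mat)
  have minor: "det (submatrix (?A ^\<^sub>m t) I J)
      = minor ((bidiag_op ^^ t) inf_id) (card I) (pick I) (pick J)"
    if "I \<subseteq> {..<Suc N}" "J \<subseteq> {..<Suc N}" "card I = card J" for I J t
    by (rule det_submatrix_eq_minor[OF At _ that]) (simp add: bidiagonal_product_pow less_Suc_eq_le)
  have "totally_nonneg ?A"
    unfolding totally_nonneg_def
  proof (intro allI impI)
    fix I J assume "I \<subseteq> {..<dim_row ?A}" "J \<subseteq> {..<dim_col ?A}" and card: "card I = card J"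
    then have IJ: "I \<subseteq> {..<Suc N}" "J \<subseteq> {..<Suc N}"
      by (simp_all only: carrier_matD[OF A])
    have "det (submatrix (?A ^\<^sub>m 1) I J) \<ge> 0"
      unfolding minor[OF IJ card]
      using inf_totally_nonneg_bidiag_op_funpow strict_mono_on_pick[of I] strict_mono_on_pick[of J] card
      unfolding inf_totally_nonneg_def by metis
    moreover have "?A ^\<^sub>m 1 = ?A"
      using left_mult_one_mat[OF A] by (simp only: One_nat_def pow_mat.simps carrier_matD[OF A])
    ultimately show "det (submatrix ?A I J) \<ge> 0"
      by (simp only:)
  qed
  moreover have "totally_pos (?A ^\<^sub>m (N + Suc N))"
    unfolding totally_pos_def
  proof (intro allI impI)
    fix I J assume "I \<subseteq> {..<dim_row (?A ^\<^sub>m (N + Suc N))}" "J \<subseteq> {..<dim_col (?A ^\<^sub>m (N + Suc N))}"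
      and card: "card I = card J"
    then have IJ: "I \<subseteq> {..<Suc N}" "J \<subseteq> {..<Suc N}"
      by (simp_all only: carrier_matD[OF At])
    have "pick I j \<le> N" "pick J j \<le> N" if "j < card I" for j
      using pick_less[OF IJ(1)] pick_less[OF IJ(2)] that card by (auto simp: less_Suc_eq_le)
    then show "det (submatrix (?A ^\<^sub>m (N + Suc N)) I J) > 0"
      unfolding minor[OF IJ card]
      using strict_mono_on_pick[of I] strict_mono_on_pick[of J] card
      by (intro minor_bidiag_op_funpow_pos) auto
  qed
  ultimately show ?thesis
    unfolding oscillatory_mat_def
    by (intro conjI exI[of _ "N + Suc N"]) (simp_all only: carrier_matD[OF A] square_mat.simps le_add2
        plus_1_eq_Suc add_Suc_right Suc_le_mono le0 One_nat_def)
qed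

end

lemma oscillatory_bidiagonal_product:
  assumes "\<And>j. x j \<ge> 0" "\<And>j. y j > 0" "\<And>j. d j > 0"
  shows "oscillatory (lower_bidiag x \<odot> lower_bidiag y \<odot> upper_bidiag d)"
  unfolding oscillatory_def
proof
  fix N
  have "truncation (lower_bidiag x \<odot> lower_bidiag y \<odot> upper_bidiag d) N
      = truncation (lower_bidiag x \<odot> lower_bidiag y) N * truncation (upper_bidiag d) N"
    by (rule truncation_mult_lower) (unfold mult_lower_bidiag, simp add: lower_bidiag_def)
  also have "truncation (lower_bidiag x \<odot> lower_bidiag y) N
      = truncation (lower_bidiag x) N * truncation (lower_bidiag y) N"
    by (rule truncation_mult_lower) (simp add: lower_bidiag_def)
  finally show "oscillatory_mat (truncation (lower_bidiag x \<odot> lower_bidiag y \<odot> upper_bidiag d) N)"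
    by (simp only: oscillatory_mat_bidiagonal_product[OF assms])
qed

section \<open>Oscillatory matrices\<close>

lemma pick_lessThan:
  assumes "i < n"
  shows "pick {..<n} i = i"
proof -
  have "{a \<in> {..<n}. a < i} = {..<i}"
    using assms by auto
  then show ?thesis
    using pick_card_in_set[of i "{..<n}"] assms by simp
qed

lemma pick_lessThan_remove:
  assumes "i < n" "k \<le> n"
  shows "pick ({..<Suc n} - {k}) i = (if i < k then i else Suc i)"
proof (cases "i < k")
  case True
  then have "{a \<in> {..<Suc n} - {k}. a < i} = {..<i}"
    using assms by auto
  then show ?thesis
    using pick_card_in_set[of i "{..<Suc n} - {k}"] assms True by simp
next
  case False
  then have "{a \<in> {..<Suc n} - {k}. a < Suc i} = {..<Suc i} - {k}"
    using assms by auto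
  moreover have "card ({..<Suc i} - {k}) = i"
    using False by simp
  ultimately show ?thesis
    using pick_card_in_set[of "Suc i" "{..<Suc n} - {k}"] assms False by simp
qed

lemma submatrix_lessThan:
  assumes "A \<in> carrier_mat n n"
  shows "submatrix A {..<n} {..<n} = A"
proof -
  have "{i. i < n \<and> i \<in> {..<n}} = {..<n}" by auto
  then show ?thesis
    using assms by (intro eq_matI) (auto simp: submatrix_def pick_lessThan)
qed

text \<open>Lets total nonnegativity apply to the minors in the last row of the adjugate.\<close>

lemma submatrix_remove_eq_mat_delete:
  assumes A: "A \<in> carrier_mat (Suc n) (Suc n)" and k: "k \<le> n"
  shows "submatrix A ({..<Suc n} - {k}) {..<n} = mat_delete A k n"
proof -
  have "{i. i < Suc n \<and> i \<in> {..<Suc n} - {k}} = {..<Suc n} - {k}"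
    "{i. i < Suc n \<and> i \<in> {..<n}} = {..<n}"
    by auto
  moreover have "card ({..<Suc n} - {k}) = n"
    using k by simp
  ultimately have sub: "submatrix A ({..<Suc n} - {k}) {..<n}
      = mat n n (\<lambda>(i, j). A $$ (pick ({..<Suc n} - {k}) i, pick {..<n} j))"
    unfolding submatrix_def carrier_matD[OF A] by (simp only: card_lessThan)
  have del: "mat_delete A k n
      = mat n n (\<lambda>(i, j). A $$ (if i < k then i else Suc i, if j < n then j else Suc j))"
    unfolding mat_delete_def carrier_matD[OF A] by (simp only: diff_Suc_1)
  show ?thesis
    unfolding sub del
    by (rule cong_mat) (simp_all only: pick_lessThan pick_lessThan_remove[OF _ k] prod.case if_True)
qed

lemma totally_nonnegD:
  assumes "totally_nonneg A" "A \<in> carrier_mat n n"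
    and "I \<subseteq> {..<n}" "J \<subseteq> {..<n}" "card I = card J"
  shows "det (submatrix A I J) \<ge> 0"
  using assms unfolding totally_nonneg_def by (metis carrier_matD)

lemma totally_posD:
  assumes "totally_pos A" "A \<in> carrier_mat n n"
    and "I \<subseteq> {..<n}" "J \<subseteq> {..<n}" "card I = card J"
  shows "det (submatrix A I J) > 0"
  using assms unfolding totally_pos_def by (metis carrier_matD)

text \<open>As a minor of \<open>A\<close>, \<open>det A\<close> is nonnegative; as a factor of the
  positive \<open>det (A ^\<^sub>m k)\<close> with \<open>k \<ge> 1\<close>, it is nonzero.\<close>

lemma oscillatory_leading_minor_pos:
  assumes "oscillatory T"
  shows "leading_minor T n > 0"
proof -
  define A where "A = truncation T n"
  have A: "A \<in> carrier_mat (Suc n) (Suc n)"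
    by (simp add: A_def)
  obtain k where k: "k \<ge> 1" and nonneg: "totally_nonneg A" and pos: "totally_pos (A ^\<^sub>m k)"
    using assms unfolding oscillatory_def oscillatory_mat_def A_def by blast
  obtain k' where k': "k = Suc k'"
    using k by (cases k) auto
  have pow: "A ^\<^sub>m t \<in> carrier_mat (Suc n) (Suc n)" for t
    using A by (rule pow_carrier_mat)
  have "det (submatrix A {..<Suc n} {..<Suc n}) \<ge> 0"
    by (rule totally_nonnegD[OF nonneg A]) (rule order_refl refl)+
  moreover have "det (submatrix (A ^\<^sub>m k) {..<Suc n} {..<Suc n}) > 0"
    by (rule totally_posD[OF pos pow]) (rule order_refl refl)+
  ultimately have "det A \<ge> 0" "det (A ^\<^sub>m k) > 0"
    using A pow by (simp_all only: submatrix_lessThan)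
  moreover have "det (A ^\<^sub>m k) = det (A ^\<^sub>m k') * det A"
    using det_mult[OF pow A] by (simp add: k')
  ultimately show ?thesis
    by (cases "det A = 0") (auto simp: leading_minor_def A_def)
qed

text \<open>The last row of the adjugate of a truncation of \<open>T = L U\<close> is annihilated by \<open>L\<close> up to its
  last entry. Its entries are minors of \<open>T\<close> up to sign, so total nonnegativity makes the
  three-term recursion of the continued fraction have a nonnegative solution.\<close>

lemma oscillatory_recursion:
  assumes osc: "oscillatory T"
    and T: "T = lower_tridiag m l \<odot> upper_bidiag d" and d: "\<And>j. d j > 0"
  obtains v :: "nat \<Rightarrow> real" where "\<And>j. v j \<ge> 0" "v n > 0" "v (Suc n) = 0"
    "\<And>j. j < n \<Longrightarrow> v j = m (Suc j) * v (Suc j) - l (Suc (Suc j)) * v (Suc (Suc j))"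
proof -
  define A where "A = truncation T n"
  have A: "A \<in> carrier_mat (Suc n) (Suc n)"
    by (simp add: A_def)
  define v where "v j = (if j \<le> n then det (mat_delete A j n) else 0)" for j
  \<comment> \<open>The sequence \<open>w\<close> is the signed last row of the adjugate, and
    \<open>z\<close> is its product with the lower factor.\<close>
  define w where "w j = (-1) ^ (n + j) * v j" for j
  define z where "z j = w j + w (Suc j) * m (Suc j) + w (Suc (Suc j)) * l (Suc (Suc j))" for j
  have v_nonneg: "v j \<ge> 0" for j
  proof (cases "j \<le> n")
    case True
    have "totally_nonneg A"
      using osc by (simp add: oscillatory_def oscillatory_mat_def A_def)
    then have "det (submatrix A ({..<Suc n} - {j}) {..<n}) \<ge> 0"
      by (rule totally_nonnegD[OF _ A]) (use True in auto)
    then show ?thesis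
      using submatrix_remove_eq_mat_delete[OF A True] True by (simp add: v_def)
  qed (simp add: v_def)
  have adj: "adj_mat A $$ (n, i) = w i" if "i \<le> n" for i
    using A that by (simp add: adj_mat_def cofactor_def w_def v_def add.commute)
  have L: "(\<Sum>i<Suc n. w i * lower_tridiag m l i j) = z j" for j
  proof -
    have "(\<Sum>i<Suc n. w i * lower_tridiag m l i j)
        = (\<Sum>i\<in>{..<Suc n} \<inter> {j, Suc j, Suc (Suc j)}. w i * lower_tridiag m l i j)"
      by (rule sum.mono_neutral_right) (auto simp: lower_tridiag_def)
    also have "\<dots> = (\<Sum>i\<in>{j, Suc j, Suc (Suc j)}. w i * lower_tridiag m l i j)"
      by (rule sum.mono_neutral_left) (auto simp: w_def v_def)
    also have "\<dots> = z j"
      by (simp add: lower_tridiag_def z_def)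
    finally show ?thesis .
  qed
  \<comment> \<open>The row \<open>w\<close> times \<open>A\<close> is \<open>det A\<close> times
    the last unit vector; by the factorization it is also \<open>z\<close> times the upper
    factor.\<close>
  have col: "z j * d j + (if j = 0 then 0 else z (j - 1)) = (if j = n then det A else 0)"
    if j: "j \<le> n" for j
  proof -
    have "(adj_mat A * A) $$ (n, j) = (\<Sum>i\<in>{0..<Suc n}. adj_mat A $$ (n, i) * A $$ (i, j))"
      using A j adj_mat(1)[OF A] by (simp add: scalar_prod_def del: sum.op_ivl_Suc)
    also have "\<dots> = (\<Sum>i<Suc n. w i * T i j)"
      unfolding lessThan_atLeast0
      by (rule sum.cong) (use j adj in \<open>auto simp: A_def truncation_def\<close>)
    also have "\<dots> = (\<Sum>i<Suc n. w i * lower_tridiag m l i j) * d j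
        + (if j = 0 then 0 else \<Sum>i<Suc n. w i * lower_tridiag m l i (j - 1))"
      by (subst T) (simp add: mult_upper_bidiag sum_distrib_right sum.distrib distrib_left
          mult.assoc del: sum.lessThan_Suc)
    finally have "(adj_mat A * A) $$ (n, j) = z j * d j + (if j = 0 then 0 else z (j - 1))"
      by (simp only: L)
    moreover have "(adj_mat A * A) $$ (n, j) = (if j = n then det A else 0)"
      unfolding adj_mat(3)[OF A] using j by simp
    ultimately show ?thesis by simp
  qed
  \<comment> \<open>Forward substitution through the upper factor, whose diagonal is
    positive.\<close>
  have z0: "z j = 0" if "j < n" for j
    using that
  proof (induction j)
    case 0
    then show ?case
      using col[of 0] d[of 0] by auto
  next
    case (Suc j)
    then show ?case
      using col[of "Suc j"] d[of "Suc j"] by auto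
  qed
  have "z n * d n = det A"
    using col[of n] z0[of "n - 1"] by (cases n) auto
  moreover have "det A > 0"
    using oscillatory_leading_minor_pos[OF osc] by (simp add: leading_minor_def A_def)
  ultimately have "z n > 0"
    using d[of n] zero_less_mult_pos2[of "z n" "d n"] by simp
  \<comment> \<open>As \<open>v\<close> vanishes beyond \<open>n\<close> and the sign at
    \<open>n\<close> is 1, \<open>z n\<close> equals \<open>v n\<close>.\<close>
  then have vn: "v n > 0"
    by (simp add: z_def w_def v_def)
  have rec: "v j = m (Suc j) * v (Suc j) - l (Suc (Suc j)) * v (Suc (Suc j))" if "j < n" for j
  proof -
    have "z j = (-1) ^ (n + j) * (v j - m (Suc j) * v (Suc j) + l (Suc (Suc j)) * v (Suc (Suc j)))"
      by (simp add: z_def w_def algebra_simps)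
    then show ?thesis
      using z0[OF that] by simp
  qed
  have "v (Suc n) = 0"
    by (simp add: v_def)
  then show ?thesis
    by (rule that[OF v_nonneg vn _ rec])
qed

section \<open>Positivity of the continued fractions of oscillatory matrices\<close>

lemma oscillatory_gauss_borel:
  assumes T: "tetradiagonal_hessenberg T" and osc: "oscillatory T"
  shows oscillatory_eq_lower_upper:
      "T = lower_tridiag (gb_m T) (gb_l T) \<odot> upper_bidiag (gb_diag T)"
    and oscillatory_gb_diag_pos: "gb_diag T n > 0"
    and oscillatory_gb_l_pos: "n \<ge> 2 \<Longrightarrow> gb_l T n > 0"
proof -
  have "leading_minor T n \<noteq> 0" for n
    using oscillatory_leading_minor_pos[OF osc, of n] by simp
  then show "T = lower_tridiag (gb_m T) (gb_l T) \<odot> upper_bidiag (gb_diag T)"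
    by (rule gauss_borel_factorization[OF T])
  have pos: "gb_diag T n > 0" for n
    using oscillatory_leading_minor_pos[OF osc] by (rule gauss_borel_pos)
  then show "gb_diag T n > 0" .
  have "\<forall>n\<ge>2. T n (n - 2) > 0"
    using T unfolding tetradiagonal_hessenberg_def by (elim conjE)
  then show "n \<ge> 2 \<Longrightarrow> gb_l T n > 0"
    unfolding gb_l_def using pos by (intro divide_pos_pos) simp_all
qed

text \<open>The recursion gives \<open>cont_frac T n k = v (k - 1) / v k\<close>. A zero
  \<open>v j\<close> with \<open>j \<ge> 1\<close> would make \<open>v (j - 1)\<close> negative, so
  only \<open>v 0\<close> may vanish and \<open>cont_frac T n 1\<close> is at first only
  nonnegative.\<close>

lemma oscillatory_cont_frac_pos:
  assumes T: "tetradiagonal_hessenberg T" and osc: "oscillatory T"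
    and k: "1 \<le> k" "k \<le> n"
  shows "cont_frac T n k > 0"
proof -
  note TLU = oscillatory_eq_lower_upper[OF T osc]
  note l = oscillatory_gb_l_pos[OF T osc]
  have *: "cont_frac T n k \<ge> 0 \<and> (k \<ge> 2 \<longrightarrow> cont_frac T n k > 0)" if k: "1 \<le> k" "k \<le> n" for n k
  proof -
    obtain v :: "nat \<Rightarrow> real" where v: "\<And>j. v j \<ge> 0" "v n > 0" "v (Suc n) = 0"
      and rec: "\<And>j. j < n \<Longrightarrow>
        v j = gb_m T (Suc j) * v (Suc j) - gb_l T (Suc (Suc j)) * v (Suc (Suc j))"
      by (rule oscillatory_recursion[OF osc TLU oscillatory_gb_diag_pos[OF T osc], of n]) blast
    have main: "v j > 0 \<and> cont_frac T n j * v j = v (j - 1)" if "j \<le> n" "1 \<le> j" for j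
      using that
    proof (induction rule: inc_induct)
      case base
      then show ?case
        using v rec[of "n - 1"] by (simp add: cont_frac_last)
    next
      case (step j)
      have S: "v (Suc j) > 0" "cont_frac T n (Suc j) * v (Suc j) = v j"
        using step by auto
      have r: "v (j - 1) = gb_m T j * v j - gb_l T (Suc j) * v (Suc j)"
        using rec[of "j - 1"] step by simp
      have "v j \<noteq> 0"
      proof
        assume "v j = 0"
        moreover have "gb_l T (Suc j) * v (Suc j) > 0"
          using l[of "Suc j"] S step by simp
        ultimately show False
          using r v(1)[of "j - 1"] by simp
      qed
      then have vj: "v j > 0"
        using v(1)[of j] by simp
      have "cont_frac T n (Suc j) = v j / v (Suc j)"
        using S by (simp add: field_simps)
      then have "cont_frac T n j = gb_m T j - gb_l T (Suc j) * v (Suc j) / v j"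
        using step by (simp add: cont_frac_rec)
      then have "cont_frac T n j * v j = gb_m T j * v j - gb_l T (Suc j) * v (Suc j)"
        using vj by (simp add: left_diff_distrib)
      with vj r show ?case by simp
    qed
    have K: "cont_frac T n k = v (k - 1) / v k" "v k > 0"
      using main[of k] k by (simp_all add: eq_divide_eq)
    moreover have "v (k - 1) > 0" if "k \<ge> 2"
      using main[of "k - 1"] k that by simp
    ultimately show ?thesis
      using v(1)[of "k - 1"] by simp
  qed
  \<comment> \<open>Strict decrease in \<open>n\<close> turns nonnegativity at \<open>Suc n\<close>
    into positivity at \<open>n\<close>, which settles \<open>k = 1\<close>.\<close>
  have "cont_frac T (Suc n) k < cont_frac T n k"
    using l * k by (intro cont_frac_Suc_less) simp_all
  then show ?thesis
    using *[of k "Suc n"] k by simp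
qed

section \<open>Shifts above and at the critical value\<close>

lemma has_PBF_E12_mult:
  assumes T: "tetradiagonal_hessenberg T" and osc: "oscillatory T" and s: "s > - inf_cont_frac T"
  shows "has_PBF (E12 s \<odot> T)"
proof -
  obtain x y where xy: "x 0 = inf_cont_frac T" "\<And>j. j \<ge> 1 \<Longrightarrow> x j > 0" "\<And>j. y j > 0"
    "\<And>n. n \<ge> 1 \<Longrightarrow> gb_m T n = x (n - 1) + y (n - 1)"
    "\<And>n. n \<ge> 2 \<Longrightarrow> gb_l T n = x (n - 1) * y (n - 2)"
    using limit_bidiagonal_factors[OF oscillatory_gb_l_pos[OF T osc] oscillatory_cont_frac_pos[OF T osc]]
    by metis
  have "has_PBF (lower_bidiag (x(0 := x 0 + s)) \<odot> lower_bidiag y \<odot> upper_bidiag (gb_diag T))"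
    by (rule has_PBF_I) (use s xy oscillatory_gb_diag_pos[OF T osc] in auto)
  moreover have "E12 s \<odot> T
      = lower_bidiag (x(0 := x 0 + s)) \<odot> lower_bidiag y \<odot> upper_bidiag (gb_diag T)"
    by (rule E12_mult_bidiagonal[OF oscillatory_eq_lower_upper[OF T osc]]) (rule xy(4,5), assumption)+
  ultimately show ?thesis by simp
qed

lemma has_PBF_critical_E12_mult:
  assumes PBF: "has_PBF T"
  shows "oscillatory (E12 (- inf_cont_frac T) \<odot> T)"
    and "inf_cont_frac (E12 (- inf_cont_frac T) \<odot> T) = 0"
proof -
  obtain a where a: "\<And>j. a j > 0" "\<And>n k. 1 \<le> k \<Longrightarrow> k \<le> n \<Longrightarrow> cont_frac T n k > a (k - 1)"
    using has_PBF_cont_frac_bound[OF PBF] by metis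
  have pos: "cont_frac T n k > 0" if "1 \<le> k" "k \<le> n" for n k
    using a(1)[of "k - 1"] a(2)[OF that] by linarith
  \<comment> \<open>The given PBF need not start with \<open>inf_cont_frac T\<close>, so the factors
    built from the limits are used: for them the shift cancels \<open>x 0\<close> exactly.\<close>
  obtain x y where lim: "(\<lambda>n. cont_frac T n 1) \<longlonglongrightarrow> inf_cont_frac T"
    and xy: "x 0 = inf_cont_frac T" "\<And>j. j \<ge> 1 \<Longrightarrow> x j > 0" "\<And>j. y j > 0"
    "\<And>n. n \<ge> 1 \<Longrightarrow> gb_m T n = x (n - 1) + y (n - 1)"
    "\<And>n. n \<ge> 2 \<Longrightarrow> gb_l T n = x (n - 1) * y (n - 2)"
    using limit_bidiagonal_factors[OF has_PBF_gb_l_pos[OF PBF] pos] by metis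
  note LU = has_PBF_eq_lower_upper[OF PBF]
  have "gb_diag T n > 0" for n
    using has_PBF_leading_minor_pos[OF PBF] by (rule gauss_borel_pos)
  then have "oscillatory (lower_bidiag (x(0 := x 0 + - inf_cont_frac T)) \<odot> lower_bidiag y
      \<odot> upper_bidiag (gb_diag T))"
    using xy(1-3) by (intro oscillatory_bidiagonal_product) (auto simp: less_imp_le)
  moreover have "E12 (- inf_cont_frac T) \<odot> T
      = lower_bidiag (x(0 := x 0 + - inf_cont_frac T)) \<odot> lower_bidiag y \<odot> upper_bidiag (gb_diag T)"
    by (rule E12_mult_bidiagonal[OF LU]) (rule xy(4,5), assumption)+
  ultimately show "oscillatory (E12 (- inf_cont_frac T) \<odot> T)" by simp
  have "leading_minor T n \<noteq> 0" for n
    using has_PBF_leading_minor_pos[OF PBF, of n] by simp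
  then show "inf_cont_frac (E12 (- inf_cont_frac T) \<odot> T) = 0"
    using inf_cont_frac_E12_mult[OF LU _ lim] by simp
qed

theorem theorem11:
  shows
    "(\<forall>T s. tetradiagonal_hessenberg T \<and> oscillatory T \<and> s > - inf_cont_frac T \<longrightarrow>
        E12 s \<odot> T = replace_b1_c1 T (T 1 0 + s * T 0 0) (T 1 1 + s) \<and>
        tetradiagonal_hessenberg (E12 s \<odot> T) \<and>
        has_PBF (E12 s \<odot> T)) \<and>
     (\<forall>T. tetradiagonal_hessenberg T \<and> has_PBF T \<longrightarrow>
        inf_cont_frac T > 0 \<and>
        (let T' = E12 (- inf_cont_frac T) \<odot> T in
           T' = replace_b1_c1 T (T 1 0 - inf_cont_frac T * T 0 0) (T 1 1 - inf_cont_frac T) \<and>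
           tetradiagonal_hessenberg T' \<and>
           oscillatory T' \<and>
           \<not> has_PBF T' \<and>
           inf_cont_frac T' = 0))"
proof (intro conjI allI impI; (elim conjE)?)
  fix T s
  assume T: "tetradiagonal_hessenberg T"
  show "E12 s \<odot> T = replace_b1_c1 T (T 1 0 + s * T 0 0) (T 1 1 + s)"
    by (rule E12_mult_eq_replace[OF T])
  show "tetradiagonal_hessenberg (E12 s \<odot> T)"
    by (rule tetradiagonal_hessenberg_E12_mult[OF T])
  assume "oscillatory T" "s > - inf_cont_frac T"
  then show "has_PBF (E12 s \<odot> T)"
    by (rule has_PBF_E12_mult[OF T])
next
  fix T
  assume T: "tetradiagonal_hessenberg T" and PBF: "has_PBF T"
  show "inf_cont_frac T > 0"
    by (rule has_PBF_inf_cont_frac_pos[OF PBF])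
  \<comment> \<open>A PBF would force a positive continued fraction, but its value here is
    0.\<close>
  have "\<not> has_PBF (E12 (- inf_cont_frac T) \<odot> T)"
    using has_PBF_critical_E12_mult(2)[OF PBF] has_PBF_inf_cont_frac_pos by fastforce
  moreover have "E12 (- inf_cont_frac T) \<odot> T
      = replace_b1_c1 T (T 1 0 - inf_cont_frac T * T 0 0) (T 1 1 - inf_cont_frac T)"
    using E12_mult_eq_replace[OF T, of "- inf_cont_frac T"]
    by (simp only: mult_minus_left add_uminus_conv_diff)
  ultimately show "let T' = E12 (- inf_cont_frac T) \<odot> T in
      T' = replace_b1_c1 T (T 1 0 - inf_cont_frac T * T 0 0) (T 1 1 - inf_cont_frac T) \<and>
      tetradiagonal_hessenberg T' \<and> oscillatory T' \<and> \<not> has_PBF T' \<and> inf_cont_frac T' = 0"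
    unfolding Let_def
    by (intro conjI tetradiagonal_hessenberg_E12_mult[OF T] has_PBF_critical_E12_mult[OF PBF])
qed

end
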